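(* Let $m\ge2$ and let $\mathbf r(t)=\sum_{i=0}^{3m-1}\mathbf r_iN^5_{i,\rho}(t)$, $t\in[t_2,t_{m+1}]$, be a clamped quintic Pythagorean-Hodograph B-spline curve with $\mathbf r'=\mathbf z^2=\sum_{k=0}^{3m-2}\mathbf p_kN^4_{k,\nu}$ and $|\mathbf r'|=\sum_{k=0}^{3m-2}\sigma_kN^4_{k,\nu}$ as described in the context, with $\mathbf z(t)\ne0$ on $[t_2,t_{m+1}]$. Let $\tau=\{\langle0\rangle^{10}<\langle t_3\rangle^8<\dots<\langle t_m\rangle^8<\langle t_{m+1}\rangle^{10}\}$, and for $0\le k\le m-1$ put $$D_k=d_k+d_{k+1},\quad S_k=\tfrac{\sigma_{3k+1}d_k+\sigma_{3k}d_{k+1}}{D_k},\quad \mathbf P_k=\tfrac{\mathbf p_{3k+1}d_k+\mathbf p_{3k}d_{k+1}}{D_k},$$ $$\mathbf U_k=\tfrac{\mathbf r_{3k+1}d_k+\mathbf r_{3k}d_{k+1}}{D_k},\quad \mathbf V_k=\tfrac{\mathbf r_{3k+2}d_k+\mathbf r_{3k+1}d_{k+1}}{D_k},\quad \mathbf Q_k=\tfrac{\mathbf r_{3k+2}d_k^2+2\mathbf r_{3k+1}d_kd_{k+1}+\mathbf r_{3k}d_{k+1}^2}{D_k^2}.$$ Then for every $h\in\mathbb R$ the offset curve $\mathbf r_h=\mathbf r-\mathrm i h\,\mathbf r'/|\mathbf r'|$ equals $$\mathbf r_h(t)=\frac{\sum_{k=0}^{8m-7}\mathbf q_kN^9_{k,\tau}(t)}{\sum_{k=0}^{8m-7}\gamma_kN^9_{k,\tau}(t)},\quad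 t\in[t_2,t_{m+1}],$$ where for $0\le k\le m-1$ $$\gamma_{8k}=\tfrac49\sigma_{3k}+\tfrac59S_k,\quad \gamma_{8k+1}=\tfrac59S_k+\tfrac49\sigma_{3k+1},$$ $$\mathbf q_{8k}=\tfrac49\mathbf Q_k\sigma_{3k}+\tfrac59\mathbf U_kS_k-\mathrm i h(\tfrac49\mathbf p_{3k}+\tfrac59\mathbf P_k),\quad \mathbf q_{8k+1}=\tfrac59\mathbf V_kS_k+\tfrac49\mathbf Q_k\sigma_{3k+1}-\mathrm i h(\tfrac49\mathbf p_{3k+1}+\tfrac59\mathbf P_k),$$ and for $0\le k\le m-2$ $$\gamma_{8k+2}=\tfrac5{18}S_k+\tfrac59\sigma_{3k+1}+\tfrac16\sigma_{3k+2},\quad \gamma_{8k+3}=\tfrac5{42}S_k+\tfrac{10}{21}\sigma_{3k+1}+\tfrac5{14}\sigma_{3k+2}+\tfrac1{21}\sigma_{3k+3},$$ $$\gamma_{8k+4}=\tfrac5{126}S_k+\tfrac{20}{63}\sigma_{3k+1}+\tfrac{10}{21}\sigma_{3k+2}+\tfrac{10}{63}\sigma_{3k+3}+\tfrac1{126}S_{k+1},$$ $$\gamma_{8k+5}=\tfrac1{126}S_k+\tfrac{10}{63}\sigma_{3k+1}+\tfrac{10}{21}\sigma_{3k+2}+\tfrac{20}{63}\sigma_{3k+3}+\tfrac5{126}S_{k+1},$$ $$\gamma_{8k+6}=\tfrac1{21}\sigma_{3k+1}+\tfrac5{14}\sigma_{3k+2}+\tfrac{10}{21}\sigma_{3k+3}+\tfrac5{42}S_{k+1},\quad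 \gamma_{8k+7}=\tfrac16\sigma_{3k+2}+\tfrac59\sigma_{3k+3}+\tfrac5{18}S_{k+1},$$ $$\mathbf q_{8k+2}=\tfrac5{18}\mathbf r_{3k+2}S_k+\tfrac59\mathbf V_k\sigma_{3k+1}+\tfrac16\mathbf Q_k\sigma_{3k+2}-\mathrm i h(\tfrac16\mathbf p_{3k+2}+\tfrac59\mathbf p_{3k+1}+\tfrac5{18}\mathbf P_k),$$ $$\mathbf q_{8k+3}=\tfrac5{42}\mathbf r_{3k+3}S_k+\tfrac{10}{21}\mathbf r_{3k+2}\sigma_{3k+1}+\tfrac5{14}\mathbf V_k\sigma_{3k+2}+\tfrac1{21}\mathbf Q_k\sigma_{3k+3}-\mathrm i h(\tfrac1{21}\mathbf p_{3k+3}+\tfrac5{14}\mathbf p_{3k+2}+\tfrac{10}{21}\mathbf p_{3k+1}+\tfrac5{42}\mathbf P_k),$$ $$\mathbf q_{8k+4}=\tfrac5{126}\mathbf U_{k+1}S_k+\tfrac{20}{63}\mathbf r_{3k+3}\sigma_{3k+1}+\tfrac{10}{21}\mathbf r_{3k+2}\sigma_{3k+2}+\tfrac{10}{63}\mathbf V_k\sigma_{3k+3}+\tfrac1{126}\mathbf Q_kS_{k+1}-\mathrm i h(\tfrac1{126}\mathbf P_{k+1}+\tfrac{10}{63}\mathbf p_{3k+3}+\tfrac{10}{21}\mathbf p_{3k+2}+\tfrac{20}{63}\mathbf p_{3k+1}+\tfrac5{126}\mathbf P_k),$$ $$\mathbf q_{8k+5}=\tfrac1{126}\mathbf Q_{k+1}S_k+\tfrac{10}{63}\mathbf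 U_{k+1}\sigma_{3k+1}+\tfrac{10}{21}\mathbf r_{3k+3}\sigma_{3k+2}+\tfrac{20}{63}\mathbf r_{3k+2}\sigma_{3k+3}+\tfrac5{126}\mathbf V_kS_{k+1}-\mathrm i h(\tfrac5{126}\mathbf P_{k+1}+\tfrac{20}{63}\mathbf p_{3k+3}+\tfrac{10}{21}\mathbf p_{3k+2}+\tfrac{10}{63}\mathbf p_{3k+1}+\tfrac1{126}\mathbf P_k),$$ $$\mathbf q_{8k+6}=\tfrac1{21}\mathbf Q_{k+1}\sigma_{3k+1}+\tfrac5{14}\mathbf U_{k+1}\sigma_{3k+2}+\tfrac{10}{21}\mathbf r_{3k+3}\sigma_{3k+3}+\tfrac5{42}\mathbf r_{3k+2}S_{k+1}-\mathrm i h(\tfrac5{42}\mathbf P_{k+1}+\tfrac{10}{21}\mathbf p_{3k+3}+\tfrac5{14}\mathbf p_{3k+2}+\tfrac1{21}\mathbf p_{3k+1}),$$ $$\mathbf q_{8k+7}=\tfrac16\mathbf Q_{k+1}\sigma_{3k+2}+\tfrac59\mathbf U_{k+1}\sigma_{3k+3}+\tfrac5{18}\mathbf r_{3k+3}S_{k+1}-\mathrm i h(\tfrac5{18}\mathbf P_{k+1}+\tfrac59\mathbf p_{3k+3}+\tfrac16\mathbf p_{3k+2}).$$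
   Context: Normalized B-splines: for a nondecreasing knot sequence $\mu=\{t_i\}$, $N^0_{i,\mu}(t)=1$ if $t\in[t_i,t_{i+1})$ and $0$ otherwise, and $N^n_{i,\mu}(t)=\frac{t-t_i}{t_{i+n}-t_i}N^{n-1}_{i,\mu}(t)+\frac{t_{i+n+1}-t}{t_{i+n+1}-t_{i+1}}N^{n-1}_{i+1,\mu}(t)$ with $0/0=0$; indexing starts at $0$. $\langle t\rangle^k$ denotes the knot $t$ repeated $k$ times. At the right end of the domain, values are left limits. Points of $\mathbb R^2$ are identified with complex numbers. Data: $0=t_2<t_3<\dots<t_{m+1}$, $d_k=t_{k+2}-t_{k+1}$ ($1\le k\le m-1$), $d_0=d_m=0$; $\mathbf z_0,\dots,\mathbf z_m\in\mathbb C$, $\mu=\{\langle0\rangle^3<t_3<\dots<t_m<\langle t_{m+1}\rangle^3\}$, $\mathbf z(t)=\sum_{i=0}^m\mathbf z_iN^2_{i,\mu}(t)$; $\nu=\{s_i\}=\{\langle0\rangle^5<\langle t_3\rangle^3<\dots<\langle t_m\rangle^3<\langle t_{m+1}\rangle^5\}$, $\rho=\{\langle0\rangle^6<\langle t_3\rangle^3<\dots<\langle t_m\rangle^3<\langle t_{m+1}\rangle^6\}$. The $\mathbf p_k$ and $\sigma_k$ ($0\le k\le 3m-2$) are the unique coefficients with $\mathbf z^2=\sum_k\mathbf p_kN^4_{k,\nu}$ and $\mathbf z\bar{\mathbf z}=\sum_k\sigma_kN^4_{k,\nu}$ on $[t_2,t_{m+1}]$; $\mathbf r_0$ is arbitrary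 and $\mathbf r_{i+1}=\mathbf r_i+\frac{s_{i+5}-s_i}5\mathbf p_i$ for $0\le i\le 3m-2$; then $\mathbf r'=\mathbf z^2$. *)

theory Defs
  imports "HOL-Analysis.Analysis"
begin

text \<open>The convention \<open>0/0 = 0\<close> needs no case distinction, since \<open>x / 0 = 0\<close> in HOL.\<close>

fun bspline :: "real list \<Rightarrow> nat \<Rightarrow> nat \<Rightarrow> real \<Rightarrow> real" where
  "bspline \<kappa> 0 i u = (if \<kappa> ! i \<le> u \<and> u < \<kappa> ! (i + 1) then 1 else 0)"
| "bspline \<kappa> (Suc n) i u =
     (u - \<kappa> ! i) / (\<kappa> ! (i + n + 1) - \<kappa> ! i) * bspline \<kappa> n i u +
     (\<kappa> ! (i + n + 2) - u) / (\<kappa> ! (i + n + 2) - \<kappa> ! (i + 1)) * bspline \<kappa> n (i + 1) u"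

text \<open>With half-open degree-zero functions, every \<^const>\<open>bspline\<close> vanishes
  at the last knot; the value there is the left limit instead.\<close>

definition bspline_cl :: "real list \<Rightarrow> nat \<Rightarrow> nat \<Rightarrow> real \<Rightarrow> real" where
  "bspline_cl \<kappa> n i u =
     (if u = last \<kappa> then Lim (at_left u) (bspline \<kappa> n i) else bspline \<kappa> n i u)"

text \<open>The spline of degree \<open>n\<close> with coefficients \<open>c 0, \<dots>, c N\<close> (both ends included).\<close>

definition spline :: "real list \<Rightarrow> nat \<Rightarrow> nat \<Rightarrow> (nat \<Rightarrow> 'a::real_vector) \<Rightarrow> real \<Rightarrow> 'a" where
  "spline \<kappa> n N c u = (\<Sum>i=0..N. bspline_cl \<kappa> n i u *\<^sub>R c i)"

text \<open>The breakpoints are \<open>t 2 < \<dots> < t (m+1)\<close>; the two end knots have multiplicity \<open>e\<close>,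
  the interior ones \<open>t 3, \<dots>, t m\<close> (none if \<open>m = 2\<close>) have multiplicity \<open>j\<close>.\<close>

definition clamped_knots :: "nat \<Rightarrow> nat \<Rightarrow> (nat \<Rightarrow> real) \<Rightarrow> nat \<Rightarrow> real list" where
  "clamped_knots e j t m =
     replicate e (t 2) @ concat (map (\<lambda>l. replicate j (t l)) [3..<m+1]) @ replicate e (t (m+1))"

text \<open>The offset at signed distance \<open>h\<close> of a plane curve on \<open>[a, b]\<close>;
  the derivative is one-sided at the end points.\<close>

definition offset_curve :: "real \<Rightarrow> real \<Rightarrow> (real \<Rightarrow> complex) \<Rightarrow> real \<Rightarrow> real \<Rightarrow> complex" where
  "offset_curve a b c h u =
     (let c' = vector_derivative c (at u within {a..b})
      in c u - \<i> * complex_of_real h * (c' / complex_of_real (norm c')))"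

end

theory Submission
  imports Defs
begin

text \<open>
  On each interval \<open>[t (k + 2), t (k + 3)]\<close> every spline involved is a single Bezier curve, since the
  interior knots have multiplicity \<open>n\<close> with degree \<open>n + 1\<close> (for \<open>\<nu>\<close> and \<open>\<tau>\<close>) or \<open>n + 2\<close> (for \<open>\<rho>\<close>):
  the B-splines of degree \<open>n\<close> are then the Bernstein polynomials, and one or two steps of the
  recursion only change the Bezier points next to the ends.
  The Bezier points are \<open>S k, \<sigma> (3k+1), \<sigma> (3k+2), \<sigma> (3k+3), S (k+1)\<close> for \<open>|r'|\<close>, the same with \<open>P\<close> and \<open>p\<close>
  for \<open>r'\<close>, and \<open>Q k, V k, r (3k+2), r (3k+3), U (k+1), Q (k+1)\<close> for \<open>r\<close>.
  Writing the offset as \<open>(\<sigma> r - \<i> h r') / \<sigma>\<close>, the formulas for \<open>\<gamma>\<close> and \<open>q\<close> are degree elevation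
  from 4 to 9 and the product of Bezier forms of degrees 4 and 5.
\<close>

subsection \<open>B-splines as Bernstein polynomials\<close>

lemma Bernstein_Suc_0: "Bernstein (Suc n) 0 x = (1 - x) * Bernstein n 0 x"
  by (simp add: Bernstein_def)

lemma Bernstein_Suc_Suc:
  "Bernstein (Suc n) (Suc l) x = x * Bernstein n l x + (1 - x) * Bernstein n (Suc l) x"
proof (cases "l < n")
  case True
  define y where "y = 1 - x"
  have "y ^ (n - l) = y * y ^ (n - Suc l)"
    using True by (metis Suc_diff_Suc power_Suc)
  then show ?thesis unfolding Bernstein_def y_def [symmetric] by (simp add: algebra_simps)
next
  case False
  then show ?thesis by (cases "l = n") (simp_all add: Bernstein_def binomial_eq_0)
qed

lemma Bernstein_eq_0: "n < l \<Longrightarrow> Bernstein n l x = 0"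
  by (simp add: Bernstein_def)

lemma bspline_eq_0_outside_span:
  assumes "sorted \<kappa>" "\<kappa> ! s \<le> u" "u < \<kappa> ! Suc s" "Suc s < length \<kappa>"
    and "i + n + 1 < length \<kappa>" "i + n < s \<or> s < i"
  shows "bspline \<kappa> n i u = 0"
  using assms(5,6)
proof (induction n arbitrary: i)
  case 0
  have "\<kappa> ! Suc i \<le> \<kappa> ! s" if "i < s"
    using that assms(1,4) by (intro sorted_nth_mono) auto
  moreover have "\<kappa> ! Suc s \<le> \<kappa> ! i" if "s < i"
    using that assms(1) 0 by (intro sorted_nth_mono) auto
  ultimately show ?case using 0 assms(2,3) by auto
next
  case (Suc n)
  then show ?case by auto
qed

text \<open>With \<open>n\<close> equal knots on each side of the span, every weight that multiplies
  a nonzero B-spline is \<open>w\<close> or \<open>1 - w\<close> in the local parameter, so the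
  B-spline recursion becomes the Bernstein recursion. For \<open>n = 0\<close> both knot conditions
  are vacuous, hence the separate equations for \<open>a\<close> and \<open>b\<close>.\<close>

lemma bspline_eq_Bernstein:
  assumes "sorted \<kappa>" "\<kappa> ! s \<le> u" "u < \<kappa> ! Suc s" "Suc s < length \<kappa>"
    and left: "\<And>i. s < i + n \<Longrightarrow> i \<le> s \<Longrightarrow> \<kappa> ! i = a"
    and right: "\<And>i. s < i \<Longrightarrow> i \<le> s + n \<Longrightarrow> \<kappa> ! i = b"
    and "a = \<kappa> ! s" "b = \<kappa> ! Suc s"
    and "i + n + 1 < length \<kappa>" "s \<le> i + n"
  shows "bspline \<kappa> n i u = Bernstein n (i + n - s) ((u - a) / (b - a))"
  using assms(9,10) left right
proof (induction n arbitrary: i)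
  case 0
  show ?case
  proof (cases "i = s")
    case True
    then show ?thesis using assms by (simp add: Bernstein_def)
  next
    case False
    then show ?thesis
      using bspline_eq_0_outside_span[OF assms(1-4), of i 0] 0 by (simp add: Bernstein_def)
  qed
next
  case (Suc n)
  let ?w = "(u - a) / (b - a)"
  have ab: "a < b" using assms by simp
  have w': "1 - ?w = (b - u) / (b - a)" using ab by (simp add: field_simps)
  have IH: "bspline \<kappa> n j u = Bernstein n (j + n - s) ?w" if "j + n + 1 < length \<kappa>" "s \<le> j + n" for j
    using that Suc.prems(3,4) by (intro Suc.IH) auto
  have zero: "bspline \<kappa> n j u = 0" if "j + n + 1 < length \<kappa>" "j + n < s \<or> s < j" for j
    using that assms by (intro bspline_eq_0_outside_span) auto
  \<comment> \<open>The span \<open>s\<close> is the last one of the support, an inner one, the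
    first one, or lies before the support. At the two end spans one of the lower-degree terms
    vanishes.\<close>
  consider "i + n + 1 = s" | "s \<le> i + n" "i < s" | "i = s" | "s < i"
    using Suc.prems by linarith
  then show ?case
  proof cases
    case 1
    then have "\<kappa> ! (i + 1) = a" "\<kappa> ! (i + n + 2) = b"
      using assms(8) by (auto intro!: Suc.prems(3))
    then show ?thesis
      using 1 Suc.prems zero[of i] IH[of "i + 1"] w' by (simp add: Bernstein_Suc_0)
  next
    case 2
    then have k: "\<kappa> ! i = a" "\<kappa> ! (i + 1) = a" "\<kappa> ! (i + n + 1) = b" "\<kappa> ! (i + n + 2) = b"
      by (auto intro!: Suc.prems(3,4))
    have "bspline \<kappa> (Suc n) i u = ?w * bspline \<kappa> n i u + (1 - ?w) * bspline \<kappa> n (i + 1) u"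
      using k w' by simp
    also have "\<dots> = Bernstein (Suc n) (Suc (i + n - s)) ?w"
      using 2 Suc.prems IH[of i] IH[of "i + 1"]
      by (simp add: Bernstein_Suc_Suc Suc_diff_le)
    finally show ?thesis using 2 by (simp add: Suc_diff_le)
  next
    case 3
    then have k: "\<kappa> ! i = a" "\<kappa> ! (i + n + 1) = b"
      by (auto intro!: Suc.prems(3,4))
    then show ?thesis
      using 3 Suc.prems IH[of i] zero[of "i + 1"]
      by (simp add: Bernstein_Suc_Suc Bernstein_eq_0)
  next
    case 4
    then show ?thesis using Suc.prems zero[of i] zero[of "i+1"] by (simp add: Bernstein_eq_0)
  qed
qed

section \<open>Entries of clamped knot sequences\<close>

lemma nth_concat_replicate:
  "i < j * length xs \<Longrightarrow> concat (map (\<lambda>l. replicate j (f l)) xs) ! i = f (xs ! (i div j))"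
proof (induction xs arbitrary: i)
  case (Cons x xs)
  then show ?case
  proof (cases "i < j")
    case False
    moreover from this have "j > 0" using Cons.prems by (auto intro: Nat.gr0I)
    ultimately have "i div j = Suc ((i - j) div j)" "j > 0"
      using Cons.prems by (auto simp: le_div_geq intro!: Nat.gr0I)
    then show ?thesis using False Cons.IH[of "i - j"] Cons.prems
      by (simp add: nth_append not_less algebra_simps)
  qed (simp add: nth_append)
qed simp

lemma length_clamped_knots [simp]: "length (clamped_knots e j t m) = 2 * e + j * (m - 2)"
proof -
  have "Suc m - 3 = m - 2" by simp
  then show ?thesis
    by (simp add: clamped_knots_def length_concat o_def sum_list_triv del: upt_Suc)
qed

lemma last_clamped_knots: "0 < e \<Longrightarrow> last (clamped_knots e j t m) = t (m + 1)"
  by (simp add: clamped_knots_def)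

text \<open>The subtraction in \<open>i + j - e\<close> truncates, so the first \<open>e\<close>
  indices all have quotient 0, and \<open>min\<close> clips the last block. One formula thus covers
  all three blocks.\<close>

lemma nth_clamped_knots:
  assumes "2 \<le> m" "0 < j" "j \<le> e" "i < 2 * e + j * (m - 2)"
  shows "clamped_knots e j t m ! i = t (min (m + 1) (2 + (i + j - e) div j))"
proof -
  consider "i < e" | "e \<le> i" "i < e + j * (m - 2)" | "e + j * (m - 2) \<le> i" by linarith
  then show ?thesis
  proof cases
    case 1
    then show ?thesis using assms by (simp add: clamped_knots_def nth_append numeral_2_eq_2)
  next
    case 2
    let ?x = "(i - e) div j"
    have x: "(i + j - e) div j = Suc ?x" using 2 assms by (simp add: le_div_geq)
    have l: "?x < m - 2" using 2 assms by (simp add: less_mult_imp_div_less algebra_simps)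
    moreover have "i - e < j * (m - 2)" using 2 by linarith
    moreover have "min m (Suc (Suc ?x)) = Suc (Suc ?x)" using l by simp
    moreover have "[3..<Suc m] ! ?x = Suc (Suc (Suc ?x))" using l by (simp del: upt_Suc)
    ultimately show ?thesis
      using 2 assms x nth_concat_replicate[of "i - e" j "[3..<m+1]" t]
      by (simp add: clamped_knots_def nth_append length_concat o_def sum_list_triv ac_simps del: upt_Suc)
  next
    case 3
    let ?x = "(i - e) div j"
    have x: "(i + j - e) div j = Suc ?x" using 3 assms by (simp add: le_div_geq)
    have l: "m - 2 \<le> ?x" using 3 assms by (simp add: less_eq_div_iff_mult_less_eq algebra_simps)
    have "i - (e + j * (m - 2)) < e" using 3 assms(4) by linarith
    moreover have "i - e < e" if "m \<le> Suc (Suc 0)" using that assms(3,4) 3 by auto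
    moreover have "\<not> i - e < j * (m - 2)" "m \<le> Suc (Suc ?x)" using 3 l by auto
    ultimately show ?thesis using 3 assms x
      by (simp add: clamped_knots_def nth_append length_concat o_def sum_list_triv ac_simps min_def del: upt_Suc)
  qed
qed

text \<open>\<alpha> is the weight \<open>(u - x) / (b - x)\<close> at \<open>u = a\<close>, and
  \<beta> is the weight \<open>(y - u) / (y - a)\<close> at \<open>u = b\<close>. An affine weight
  is determined by its values at \<open>a\<close> and \<open>b\<close>, which yields these forms in
  \<open>w\<close>.\<close>

lemma affine_weights:
  fixes a b x y u :: real
  assumes "a < b" "x < b" "a < y"
    and \<alpha>: "\<alpha> = (a - x) / (b - x)" and \<beta>: "\<beta> = (y - b) / (y - a)" and w: "w = (u - a) / (b - a)"
  shows "(b - u) / (b - x) = (1 - \<alpha>) * (1 - w)" "(u - x) / (b - x) = w + \<alpha> * (1 - w)"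
    "(u - a) / (y - a) = (1 - \<beta>) * w" "(y - u) / (y - a) = 1 - w + \<beta> * w"
    "(u - a) / (b - a) = w" "(b - u) / (b - a) = 1 - w"
proof -
  have \<alpha>': "1 - \<alpha> = (b - a) / (b - x)" and \<beta>': "1 - \<beta> = (b - a) / (y - a)"
    and w': "1 - w = (b - u) / (b - a)"
    using assms by (simp_all add: field_simps)
  show 1: "(b - u) / (b - x) = (1 - \<alpha>) * (1 - w)" unfolding \<alpha>' w' using assms(1) by simp
  show 2: "(u - a) / (y - a) = (1 - \<beta>) * w" unfolding \<beta>' w using assms(1) by simp
  have "(u - x) / (b - x) = 1 - (b - u) / (b - x)" using assms(2) by (simp add: field_simps)
  then show "(u - x) / (b - x) = w + \<alpha> * (1 - w)" unfolding 1 by (simp add: algebra_simps)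
  have "(y - u) / (y - a) = 1 - (u - a) / (y - a)" using assms(3) by (simp add: field_simps)
  then show "(y - u) / (y - a) = 1 - w + \<beta> * w" unfolding 2 by (simp add: algebra_simps)
  show "(u - a) / (b - a) = w" "(b - u) / (b - a) = 1 - w" using w w' by simp_all
qed

text \<open>The degree \<open>n\<close> functions are Bernstein polynomials already, and one more
  recursion step meets the outer knots only near the ends. The knot \<open>x\<close> splits
  Bernstein polynomial 0 between \<open>l = 0\<close> and \<open>l = 1\<close> with shares 1 -
  \<alpha> and \<alpha>; the knot \<open>y\<close> splits polynomial \<open>n + 1\<close> between
  \<open>l = n + 1\<close> and \<open>l = n\<close> with shares 1 - \<beta> and \<beta>.\<close>

lemma bspline_Suc_eq_Bernstein:
  assumes "sorted \<kappa>" "0 < n" "s = q + n + 1" "\<kappa> ! s \<le> u" "u < \<kappa> ! Suc s"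
    and len: "q + 2 * n + 2 < length \<kappa>"
    and left: "\<And>i. q + 2 \<le> i \<Longrightarrow> i \<le> s \<Longrightarrow> \<kappa> ! i = a"
    and right: "\<And>i. s < i \<Longrightarrow> i \<le> s + n \<Longrightarrow> \<kappa> ! i = b"
    and x: "x = \<kappa> ! (q + 1)" and y: "y = \<kappa> ! (q + 2 * n + 2)"
    and \<alpha>: "\<alpha> = (a - x) / (b - x)" and \<beta>: "\<beta> = (y - b) / (y - a)"
    and w: "w = (u - a) / (b - a)" and l: "l \<le> n + 1" "q + l + n + 2 < length \<kappa>"
  shows "bspline \<kappa> (Suc n) (q + l) u =
      (if l = 0 then 1 - \<alpha> else if l = n + 1 then 1 - \<beta> else 1) * Bernstein (n + 1) l w
      + (if l = 1 then \<alpha> * Bernstein (n + 1) 0 w else 0)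
      + (if l = n then \<beta> * Bernstein (n + 1) (n + 1) w else 0)"
proof -
  have a: "\<kappa> ! s = a" using assms(2,3) by (intro left) auto
  have b: "\<kappa> ! Suc s = b" using assms(2,3) by (intro right) auto
  have ab: "a < b" using assms(4,5) a b by simp
  have "x \<le> a" "b \<le> y" unfolding x y a[symmetric] b[symmetric]
    using assms(1,2,3) len by (auto intro!: sorted_nth_mono)
  then have xb: "x < b" and ay: "a < y" using ab by auto
  have main: "bspline \<kappa> n j u = Bernstein n (j + n - s) w"
    if "j + n + 1 < length \<kappa>" "s \<le> j + n" for j
    unfolding w using that assms(2,3,4,5) len a b
    by (intro bspline_eq_Bernstein assms(1) left right) auto
  have zero: "bspline \<kappa> n j u = 0" if "j + n + 1 < length \<kappa>" "j + n < s \<or> s < j" for j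
    using that assms(1,3,4,5) len by (intro bspline_eq_0_outside_span[of \<kappa> s]) auto
  have w1: "(b - u) / (b - x) = (1 - \<alpha>) * (1 - w)" "(u - x) / (b - x) = w + \<alpha> * (1 - w)"
    "(u - a) / (y - a) = (1 - \<beta>) * w" "(y - u) / (y - a) = 1 - w + \<beta> * w"
    "(u - a) / (b - a) = w" "(b - u) / (b - a) = 1 - w"
    using affine_weights[OF ab xb ay \<alpha> \<beta> w] by simp_all
  consider "l = 0" | "l = n + 1" | l' where "l = Suc l'" "l' < n"
    using l by (cases l) (auto simp: le_eq_less_or_eq)
  then show ?thesis
  proof cases
    case 1
    have "\<kappa> ! (q + n + 2) = b" using b assms(3) by simp
    then show ?thesis
      using 1 assms(2,3) l zero[of q] main[of "q + 1"] w1(1) x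
      by (simp add: Bernstein_Suc_0)
  next
    case 2
    have "\<kappa> ! (q + n + 1) = a" using a assms(3) by simp
    moreover have "\<kappa> ! Suc (Suc (n + (n + q))) = y" unfolding y mult_2 by (simp add: ac_simps)
    ultimately show ?thesis
      using 2 assms(2,3) l zero[of "q + n + 2"] main[of "q + n + 1"] w1(3)
      by (simp add: Bernstein_Suc_Suc Bernstein_eq_0 ac_simps)
  next
    case 3
    have k: "\<kappa> ! (q + l + 1) = a" "\<kappa> ! (q + l + n + 1) = b"
      using 3 assms(3) by (auto intro!: left right)
    have f: "(u - \<kappa> ! (q + l)) / (\<kappa> ! (q + l + n + 1) - \<kappa> ! (q + l))
        = w + (if l = 1 then \<alpha> * (1 - w) else 0)"
    proof (cases "l = 1")
      case True
      then show ?thesis using k w1(2) x by simp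
    next
      case False
      then have "\<kappa> ! (q + l) = a" using 3 assms(3) by (intro left) auto
      then show ?thesis using False k w1(5) by simp
    qed
    have g: "(\<kappa> ! (q + l + n + 2) - u) / (\<kappa> ! (q + l + n + 2) - \<kappa> ! (q + l + 1))
        = 1 - w + (if l = n then \<beta> * w else 0)"
    proof (cases "l = n")
      case True
      then have "\<kappa> ! (q + l + n + 2) = y" unfolding y mult_2 by (simp add: ac_simps)
      then show ?thesis using True k w1(4) by simp
    next
      case False
      then have "\<kappa> ! (q + l + n + 2) = b" using 3 assms(3) by (intro right) auto
      then show ?thesis using False k w1(6) by simp
    qed
    have "bspline \<kappa> (Suc n) (q + l) u =
       (w + (if l = 1 then \<alpha> * (1 - w) else 0)) * Bernstein n l' w
       + (1 - w + (if l = n then \<beta> * w else 0)) * Bernstein n (Suc l') w"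
      unfolding bspline.simps f g
      using 3 assms(3) l main[of "q + l"] main[of "q + l + 1"] by simp
    then show ?thesis using 3
      by (simp add: Bernstein_Suc_Suc Bernstein_Suc_0 Bernstein_eq_0 algebra_simps)
  qed
qed

section \<open>Evaluation of splines: active basis functions and left limits\<close>

lemma sum_bspline_span:
  fixes c :: "nat \<Rightarrow> 'a::real_vector"
  assumes "sorted \<kappa>" "s = q + n" "\<kappa> ! s \<le> u" "u < \<kappa> ! Suc s" "s \<le> N" "N + n + 1 < length \<kappa>"
  shows "(\<Sum>i=0..N. bspline \<kappa> n i u *\<^sub>R c i) = (\<Sum>l\<le>n. bspline \<kappa> n (q + l) u *\<^sub>R c (q + l))"
proof -
  have "(\<Sum>i=0..N. bspline \<kappa> n i u *\<^sub>R c i) = (\<Sum>i=q..q+n. bspline \<kappa> n i u *\<^sub>R c i)"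
  proof (rule sum.mono_neutral_right)
    show "\<forall>i\<in>{0..N} - {q..q+n}. bspline \<kappa> n i u *\<^sub>R c i = 0"
    proof
      fix i assume "i \<in> {0..N} - {q..q+n}"
      then have "bspline \<kappa> n i u = 0"
        using assms by (intro bspline_eq_0_outside_span[of \<kappa> s]) auto
      then show "bspline \<kappa> n i u *\<^sub>R c i = 0" by simp
    qed
  qed (use assms in auto)
  also have "\<dots> = (\<Sum>l\<le>n. bspline \<kappa> n (q + l) u *\<^sub>R c (q + l))"
    using sum.shift_bounds_cl_nat_ivl[of "\<lambda>i. bspline \<kappa> n i u *\<^sub>R c i" 0 q n]
    by (simp add: atMost_atLeast0 ac_simps)
  finally show ?thesis .
qed

text \<open>\<open>Lim\<close> is a definite description, so it can be used only once some limit is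
  known to exist. In degree 0 the function is constant just left of \<open>u\<close>, and the
  recursion preserves one-sided limits.\<close>

lemma tendsto_bspline_at_left:
  "(bspline \<kappa> n i \<longlongrightarrow> Lim (at_left u) (bspline \<kappa> n i)) (at_left u)"
proof -
  have "\<exists>L. (bspline \<kappa> n i \<longlongrightarrow> L) (at_left u)"
  proof (induction n arbitrary: i)
    case 0
    define L where "L = (if \<kappa> ! i < u \<and> u \<le> \<kappa> ! (i + 1) then 1 else 0 :: real)"
    have "\<exists>b<u. \<forall>v>b. v < u \<longrightarrow> bspline \<kappa> 0 i v = L"
    proof -
      consider "u \<le> \<kappa> ! i" | "\<kappa> ! (i + 1) < u" | "\<kappa> ! i < u" "u \<le> \<kappa> ! (i + 1)" by linarith
      then show ?thesis
      proof cases
        case 1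
        then show ?thesis by (intro exI[of _ "u - 1"]) (auto simp: L_def)
      next
        case 2
        then show ?thesis by (intro exI[of _ "\<kappa> ! (i + 1)"]) (auto simp: L_def)
      next
        case 3
        then show ?thesis by (intro exI[of _ "\<kappa> ! i"]) (auto simp: L_def)
      qed
    qed
    then have "eventually (\<lambda>v. bspline \<kappa> 0 i v = L) (at_left u)"
      by (subst eventually_at_left[of "u - 1"]) auto
    then show ?case by (blast intro: tendsto_eventually)
  next
    case (Suc n)
    obtain L L' where "(bspline \<kappa> n i \<longlongrightarrow> L) (at_left u)" "(bspline \<kappa> n (i + 1) \<longlongrightarrow> L') (at_left u)"
      using Suc.IH by blast
    then show ?case
      \<comment> \<open>The denominators are constants that may be 0; written as factors
        \<open>inverse\<close> they need no non-vanishing condition.\<close>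
      unfolding bspline.simps divide_inverse by (intro exI) (rule tendsto_intros | assumption)+
  qed
  then show ?thesis by (metis tendsto_Lim trivial_limit_at_left_real)
qed

lemma spline_eq_sum_bspline:
  "u \<noteq> last \<kappa> \<Longrightarrow> spline \<kappa> n N c u = (\<Sum>i=0..N. bspline \<kappa> n i u *\<^sub>R c i)"
  by (simp add: spline_def bspline_cl_def)

text \<open>At the last knot a spline is its own left limit. Left limits are unique, so a closed
  form valid before that knot carries over by continuity of \<open>g\<close>.\<close>

lemma spline_last_eq:
  fixes c :: "nat \<Rightarrow> 'a::real_normed_vector"
  assumes "a < last \<kappa>" "\<And>v. a \<le> v \<Longrightarrow> v < last \<kappa> \<Longrightarrow> spline \<kappa> n N c v = g v" "isCont g (last \<kappa>)"
  shows "spline \<kappa> n N c (last \<kappa>) = g (last \<kappa>)"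
proof -
  let ?b = "last \<kappa>"
  have "((\<lambda>v. \<Sum>i=0..N. bspline \<kappa> n i v *\<^sub>R c i) \<longlongrightarrow> spline \<kappa> n N c ?b) (at_left ?b)"
    unfolding spline_def bspline_cl_def
    by (auto intro!: tendsto_intros tendsto_bspline_at_left)
  moreover have "eventually (\<lambda>v. (\<Sum>i=0..N. bspline \<kappa> n i v *\<^sub>R c i) = g v) (at_left ?b)"
    unfolding eventually_at_left[OF assms(1)]
    using assms(1,2) by (intro exI[of _ a]) (auto simp: spline_eq_sum_bspline)
  ultimately have "(g \<longlongrightarrow> spline \<kappa> n N c ?b) (at_left ?b)"
    by (simp add: tendsto_cong)
  moreover have "(g \<longlongrightarrow> g ?b) (at_left ?b)"
    using assms(3) by (auto simp: isCont_def intro: tendsto_within_subset)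
  ultimately show ?thesis using tendsto_unique trivial_limit_at_left_real by blast
qed

section \<open>Bezier forms and their derivatives\<close>

definition bezier :: "nat \<Rightarrow> (nat \<Rightarrow> 'a::real_vector) \<Rightarrow> real \<Rightarrow> 'a" where
  "bezier n c w = (\<Sum>l\<le>n. Bernstein n l w *\<^sub>R c l)"

lemma bezier_0: "bezier n c 0 = c 0"
proof -
  have "bezier n c 0 = (\<Sum>l\<le>n. if l = 0 then c 0 else 0)"
    unfolding bezier_def by (rule sum.cong) (auto simp: Bernstein_def)
  then show ?thesis by simp
qed

lemma bezier_1: "bezier n c 1 = c n"
proof -
  have "bezier n c 1 = (\<Sum>l\<le>n. if l = n then c n else 0)"
    unfolding bezier_def by (rule sum.cong) (auto simp: Bernstein_def)
  then show ?thesis by simp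
qed

lemma isCont_Bernstein [continuous_intros]: "isCont (Bernstein n l) w"
  unfolding Bernstein_def by (intro continuous_intros)

lemma isCont_bezier: "isCont (bezier n c :: real \<Rightarrow> 'a::real_normed_vector) w"
  unfolding bezier_def by (intro continuous_intros)

lemma DERIV_Bernstein_0:
  "(Bernstein (Suc n) 0 has_real_derivative - real (Suc n) * Bernstein n 0 w) (at w)"
proof -
  have eq: "Bernstein (Suc n) 0 = (\<lambda>w. (1 - w) ^ Suc n)"
    by (simp add: Bernstein_def fun_eq_iff)
  show ?thesis unfolding eq
    by (rule derivative_eq_intros refl)+ (simp add: Bernstein_def algebra_simps)
qed

lemma DERIV_Bernstein_Suc:
  "(Bernstein (Suc n) (Suc l) has_real_derivative
     real (Suc n) * (Bernstein n l w - Bernstein n (Suc l) w)) (at w)"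
proof (induction n arbitrary: l)
  case 0
  have "Bernstein (Suc 0) (Suc l) = (\<lambda>w. if l = 0 then w else 0)"
    by (auto simp: Bernstein_def fun_eq_iff)
  moreover have "Bernstein 0 l w - Bernstein 0 (Suc l) w = (if l = 0 then 1 else 0)"
    by (simp add: Bernstein_def)
  ultimately show ?case by (cases "l = 0") (auto intro!: derivative_eq_intros)
next
  case (Suc n)
  have eq: "Bernstein (Suc (Suc n)) (Suc k) =
      (\<lambda>w. w * Bernstein (Suc n) k w + (1 - w) * Bernstein (Suc n) (Suc k) w)" for k
    by (rule ext) (rule Bernstein_Suc_Suc)
  show ?case
  proof (cases l)
    case 0
    show ?thesis unfolding eq 0
      by (rule derivative_eq_intros DERIV_Bernstein_0 Suc refl)+
        (simp add: Bernstein_Suc_Suc Bernstein_Suc_0 algebra_simps)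
  next
    case (Suc k)
    show ?thesis unfolding eq Suc
      by (rule derivative_eq_intros Suc.IH refl)+
        (simp add: Bernstein_Suc_Suc algebra_simps)
  qed
qed

text \<open>The derivative of a Bernstein polynomial is a difference of two of lower degree;
  summation by parts moves this difference onto the control points.\<close>

lemma has_vector_derivative_bezier:
  fixes c :: "nat \<Rightarrow> 'a::real_normed_vector"
  shows "(bezier (Suc n) c has_vector_derivative
    real (Suc n) *\<^sub>R bezier n (\<lambda>l. c (Suc l) - c l) w) (at w)"
proof -
  have eq: "bezier (Suc n) c = (\<lambda>w. Bernstein (Suc n) 0 w *\<^sub>R c 0
      + (\<Sum>l\<le>n. Bernstein (Suc n) (Suc l) w *\<^sub>R c (Suc l)))"
    by (rule ext) (simp add: bezier_def sum.atMost_Suc_shift del: sum.atMost_Suc)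
  \<comment> \<open>The index shift adds no term at the top, since
    \<open>Bernstein n (Suc n)\<close> is 0.\<close>
  have S: "(\<Sum>l\<le>n. Bernstein n l w *\<^sub>R c l) =
      Bernstein n 0 w *\<^sub>R c 0 + (\<Sum>l\<le>n. Bernstein n (Suc l) w *\<^sub>R c (Suc l))"
    using sum.atMost_Suc_shift[of "\<lambda>l. Bernstein n l w *\<^sub>R c l" n] by (simp add: Bernstein_eq_0)
  have "(bezier (Suc n) c has_vector_derivative
      (- real (Suc n) * Bernstein n 0 w) *\<^sub>R c 0
      + (\<Sum>l\<le>n. (real (Suc n) * (Bernstein n l w - Bernstein n (Suc l) w)) *\<^sub>R c (Suc l))) (at w)"
    unfolding eq
    by (intro has_vector_derivative_add has_vector_derivative_sum
        has_vector_derivative_scaleR[where g'=0, simplified] DERIV_Bernstein_0 DERIV_Bernstein_Suc)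
      auto
  also have "(- N * Bernstein n 0 w) *\<^sub>R c 0
      + (\<Sum>l\<le>n. (N * (Bernstein n l w - Bernstein n (Suc l) w)) *\<^sub>R c (Suc l))
    = N *\<^sub>R bezier n (\<lambda>l. c (Suc l) - c l) w" for N :: real
    by (simp add: bezier_def S scaleR_diff_right sum_subtractf scaleR_diff_left right_diff_distrib
        scaleR_add_right scaleR_sum_right)
  finally show ?thesis .
qed

text \<open>Triple knots give Bernstein polynomials in degree 3, two recursion steps below. The
  outer knots \<open>x\<close> and \<open>y\<close> occur twice as well, so both steps use the same
  ratios \<alpha> and \<beta>, whence the quadratic weights.\<close>

lemma bspline_quintic_eq_Bernstein:
  assumes "sorted \<kappa>" "\<kappa> ! (q + 5) \<le> u" "u < \<kappa> ! (q + 6)"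
    and len: "q + 11 < length \<kappa>"
    and k: "\<kappa> ! (q + 1) = x" "\<kappa> ! (q + 2) = x" "\<kappa> ! (q + 3) = a" "\<kappa> ! (q + 4) = a" "\<kappa> ! (q + 5) = a"
      "\<kappa> ! (q + 6) = b" "\<kappa> ! (q + 7) = b" "\<kappa> ! (q + 8) = b" "\<kappa> ! (q + 9) = y" "\<kappa> ! (q + 10) = y"
    and \<alpha>: "\<alpha> = (a - x) / (b - x)" and \<beta>: "\<beta> = (y - b) / (y - a)"
    and w: "w = (u - a) / (b - a)"
  shows "bspline \<kappa> 5 q u = (1 - \<alpha>)\<^sup>2 * Bernstein 5 0 w"
    and "bspline \<kappa> 5 (q + 1) u = 2 * \<alpha> * (1 - \<alpha>) * Bernstein 5 0 w + (1 - \<alpha>) * Bernstein 5 1 w"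
    and "bspline \<kappa> 5 (q + 2) u = \<alpha>\<^sup>2 * Bernstein 5 0 w + \<alpha> * Bernstein 5 1 w + Bernstein 5 2 w"
    and "bspline \<kappa> 5 (q + 3) u = Bernstein 5 3 w + \<beta> * Bernstein 5 4 w + \<beta>\<^sup>2 * Bernstein 5 5 w"
    and "bspline \<kappa> 5 (q + 4) u = (1 - \<beta>) * Bernstein 5 4 w + 2 * \<beta> * (1 - \<beta>) * Bernstein 5 5 w"
    and "bspline \<kappa> 5 (q + 5) u = (1 - \<beta>)\<^sup>2 * Bernstein 5 5 w"
proof -
  have ab: "a < b" using assms by simp
  have "\<kappa> ! (q + 1) \<le> \<kappa> ! (q + 3)" "\<kappa> ! (q + 6) \<le> \<kappa> ! (q + 9)"
    using assms(1) len by (auto intro!: sorted_nth_mono)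
  then have xb: "x < b" and ay: "a < y" using ab k by auto
  have w1: "(b - u) / (b - x) = (1 - \<alpha>) * (1 - w)" "(u - x) / (b - x) = w + \<alpha> * (1 - w)"
    "(u - a) / (y - a) = (1 - \<beta>) * w" "(y - u) / (y - a) = 1 - w + \<beta> * w"
    "(u - a) / (b - a) = w" "(b - u) / (b - a) = 1 - w"
    using affine_weights[OF ab xb ay \<alpha> \<beta> w] by simp_all
  have left: "\<kappa> ! i = a" if "q + 1 + 2 \<le> i" "i \<le> q + 5" for i
  proof -
    have "i = q + 3 \<or> i = q + 4 \<or> i = q + 5" using that by linarith
    then show ?thesis using k by auto
  qed
  have right: "\<kappa> ! i = b" if "q + 5 < i" "i \<le> q + 5 + 3" for i
  proof -
    have "i = q + 6 \<or> i = q + 7 \<or> i = q + 8" using that by linarith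
    then show ?thesis using k by auto
  qed
  have N4: "bspline \<kappa> 4 j u =
      (if l = 0 then 1 - \<alpha> else if l = 4 then 1 - \<beta> else 1) * Bernstein 4 l w
      + (if l = 1 then \<alpha> * Bernstein 4 0 w else 0)
      + (if l = 3 then \<beta> * Bernstein 4 4 w else 0)" if "l \<le> 4" "j = q + 1 + l" for l j
  proof -
    have "bspline \<kappa> (Suc 3) (q + 1 + l) u =
      (if l = 0 then 1 - \<alpha> else if l = 3 + 1 then 1 - \<beta> else 1) * Bernstein (3 + 1) l w
      + (if l = 1 then \<alpha> * Bernstein (3 + 1) 0 w else 0)
      + (if l = 3 then \<beta> * Bernstein (3 + 1) (3 + 1) w else 0)"
      by (rule bspline_Suc_eq_Bernstein[where s = "q + 5" and a = a and b = b and x = x and y = y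
            and u = u, OF assms(1) _ _ _ _ _ left right _ _ \<alpha> \<beta> w])
        (use assms(2,3) len k that in \<open>auto simp: ac_simps\<close>)
    then show ?thesis using that(2) by simp
  qed
  \<comment> \<open>These vanish, so the knots at \<open>q\<close> and \<open>q + 11\<close>, about
    whose values nothing is assumed, drop out of the recursion.\<close>
  have zero: "bspline \<kappa> 4 q u = 0" "bspline \<kappa> 4 (q + 6) u = 0"
    by (rule bspline_eq_0_outside_span[OF assms(1), of "q + 5"]; use assms(2,3) len in \<open>simp add: ac_simps\<close>)+
  have rec: "bspline \<kappa> 5 i u = (u - \<kappa> ! i) / (\<kappa> ! i5 - \<kappa> ! i) * bspline \<kappa> 4 i u
      + (\<kappa> ! i6 - u) / (\<kappa> ! i6 - \<kappa> ! i1) * bspline \<kappa> 4 i1 u"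
    if "i1 = i + 1" "i5 = i + 5" "i6 = i + 6" for i i1 i5 i6
    using bspline.simps(2)[of \<kappa> 4 i u] that by (simp add: numeral_eq_Suc)
  have B: "Bernstein 5 0 w = (1 - w) * Bernstein 4 0 w"
    "Bernstein 5 1 w = w * Bernstein 4 0 w + (1 - w) * Bernstein 4 1 w"
    "Bernstein 5 2 w = w * Bernstein 4 1 w + (1 - w) * Bernstein 4 2 w"
    "Bernstein 5 3 w = w * Bernstein 4 2 w + (1 - w) * Bernstein 4 3 w"
    "Bernstein 5 4 w = w * Bernstein 4 3 w + (1 - w) * Bernstein 4 4 w"
    "Bernstein 5 5 w = w * Bernstein 4 4 w"
    by (simp_all add: Bernstein_def eval_nat_numeral algebra_simps)
  have N: "bspline \<kappa> 4 (q + 1) u = (1 - \<alpha>) * Bernstein 4 0 w"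
    "bspline \<kappa> 4 (q + 2) u = Bernstein 4 1 w + \<alpha> * Bernstein 4 0 w"
    "bspline \<kappa> 4 (q + 3) u = Bernstein 4 2 w"
    "bspline \<kappa> 4 (q + 4) u = Bernstein 4 3 w + \<beta> * Bernstein 4 4 w"
    "bspline \<kappa> 4 (q + 5) u = (1 - \<beta>) * Bernstein 4 4 w"
    using N4[of 0 "q + 1"] N4[of 1 "q + 2"] N4[of 2 "q + 3"] N4[of 3 "q + 4"] N4[of 4 "q + 5"]
    by simp_all
  show "bspline \<kappa> 5 q u = (1 - \<alpha>)\<^sup>2 * Bernstein 5 0 w"
    by (subst rec[of "q + 1" q "q + 5" "q + 6"]; (simp only: k N zero w1 B)?; simp add: power2_eq_square algebra_simps)
  show "bspline \<kappa> 5 (q + 1) u = 2 * \<alpha> * (1 - \<alpha>) * Bernstein 5 0 w + (1 - \<alpha>) * Bernstein 5 1 w"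
    by (subst rec[of "q + 2" "q + 1" "q + 6" "q + 7"]; (simp only: k N zero w1 B)?; simp add: power2_eq_square algebra_simps)
  show "bspline \<kappa> 5 (q + 2) u = \<alpha>\<^sup>2 * Bernstein 5 0 w + \<alpha> * Bernstein 5 1 w + Bernstein 5 2 w"
    by (subst rec[of "q + 3" "q + 2" "q + 7" "q + 8"]; (simp only: k N zero w1 B)?; simp add: power2_eq_square algebra_simps)
  show "bspline \<kappa> 5 (q + 3) u = Bernstein 5 3 w + \<beta> * Bernstein 5 4 w + \<beta>\<^sup>2 * Bernstein 5 5 w"
    by (subst rec[of "q + 4" "q + 3" "q + 8" "q + 9"]; (simp only: k N zero w1 B)?; simp add: power2_eq_square algebra_simps)
  show "bspline \<kappa> 5 (q + 4) u = (1 - \<beta>) * Bernstein 5 4 w + 2 * \<beta> * (1 - \<beta>) * Bernstein 5 5 w"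
    by (subst rec[of "q + 5" "q + 4" "q + 9" "q + 10"]; (simp only: k N zero w1 B)?; simp add: power2_eq_square algebra_simps)
  show "bspline \<kappa> 5 (q + 5) u = (1 - \<beta>)\<^sup>2 * Bernstein 5 5 w"
    by (subst rec[of "q + 6" "q + 5" "q + 10" "q + 11"]; (simp only: k N zero w1 B)?; simp add: power2_eq_square algebra_simps)
qed

subsection \<open>Bezier form of clamped splines\<close>

lemma bezier_cong: "(\<And>l. l \<le> n \<Longrightarrow> c l = c' l) \<Longrightarrow> bezier n c w = bezier n c' w"
  by (simp add: bezier_def)

lemma bezier_scaleR: "bezier n (\<lambda>l. x *\<^sub>R c l) w = x *\<^sub>R bezier n c w"
  by (simp add: bezier_def scaleR_sum_right mult.commute)

text \<open>This transposes the relation in \<open>bspline_Suc_eq_Bernstein\<close>: the sum is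
  collected by Bernstein polynomials instead of B-splines, so that only the two end control points
  become mixtures.\<close>

lemma sum_break_eq_bezier:
  fixes e :: "nat \<Rightarrow> 'a::real_vector"
  assumes "0 < n"
  shows "(\<Sum>l\<le>Suc n. ((if l = 0 then 1 - \<alpha> else if l = n + 1 then 1 - \<beta> else 1) * Bernstein (n + 1) l w
      + (if l = 1 then \<alpha> * Bernstein (n + 1) 0 w else 0)
      + (if l = n then \<beta> * Bernstein (n + 1) (n + 1) w else 0)) *\<^sub>R e l)
    = bezier (Suc n) (\<lambda>l. if l = 0 then \<alpha> *\<^sub>R e 1 + (1 - \<alpha>) *\<^sub>R e 0
        else if l = n + 1 then (1 - \<beta>) *\<^sub>R e (n + 1) + \<beta> *\<^sub>R e n else e l) w"
    (is "?L = ?R")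
proof -
  let ?A = "\<lambda>l. (if l = 0 then 1 - \<alpha> else if l = n + 1 then 1 - \<beta> else 1) * Bernstein (n + 1) l w"
  let ?B0 = "\<alpha> * Bernstein (n + 1) 0 w" and ?Bn = "\<beta> * Bernstein (n + 1) (n + 1) w"
  have "?L = (\<Sum>l\<le>Suc n. ?A l *\<^sub>R e l + (if l = 1 then ?B0 *\<^sub>R e 1 else 0)
      + (if l = n then ?Bn *\<^sub>R e n else 0))"
    by (rule sum.cong) (auto simp: scaleR_add_left)
  also have "\<dots> = (\<Sum>l\<le>Suc n. ?A l *\<^sub>R e l) + ?B0 *\<^sub>R e 1 + ?Bn *\<^sub>R e n"
    by (simp add: sum.distrib del: sum.atMost_Suc)
  \<comment> \<open>The two corrections keep their values but move from indices 1 and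
    \<open>n\<close> to 0 and \<open>n + 1\<close>, the indices of the Bernstein polynomials they
    contain.\<close>
  also have "\<dots> = (\<Sum>l\<le>Suc n. ?A l *\<^sub>R e l + (if l = 0 then ?B0 *\<^sub>R e 1 else 0)
      + (if l = n + 1 then ?Bn *\<^sub>R e n else 0))"
    by (simp add: sum.distrib del: sum.atMost_Suc)
  also have "\<dots> = ?R"
    unfolding bezier_def by (rule sum.cong) (auto simp: scaleR_add_right mult.commute)
  finally show ?thesis .
qed

text \<open>At \<open>b\<close> the limit within the union amounts to the two one-sided limits, and
  both derivatives are \<open>g b\<close>. Away from \<open>b\<close> only one of the two intervals
  matters locally.\<close>

lemma has_vector_derivative_glue:
  fixes a b c :: real
  assumes "a \<le> b" "b \<le> c"
    and ab: "\<And>x. x \<in> {a..b} \<Longrightarrow> (f has_vector_derivative g x) (at x within {a..b})"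
    and bc: "\<And>x. x \<in> {b..c} \<Longrightarrow> (f has_vector_derivative g x) (at x within {b..c})"
    and "x \<in> {a..c}"
  shows "(f has_vector_derivative g x) (at x within {a..c})"
proof -
  consider "x < b" | "x = b" | "b < x" by linarith
  then show ?thesis
  proof cases
    case 1
    then have "at x within {a..c} = at x within {a..b}"
      using assms by (intro at_within_nhd[of _ "{..<b}"]) auto
    then show ?thesis using 1 assms(5) ab[of x] by simp
  next
    case 2
    have "{a..c} = {a..b} \<union> {b..c}" using assms by auto
    moreover have "(f has_vector_derivative g x) (at x within {a..b})"
      "(f has_vector_derivative g x) (at x within {b..c})"
      using 2 assms by auto
    ultimately show ?thesis
      by (simp add: has_vector_derivative_def has_derivative_within Lim_within_Un)
  next
    case 3
    then have "at x within {a..c} = at x within {b..c}"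
      using assms by (intro at_within_nhd[of _ "{b<..}"]) auto
    then show ?thesis using 3 assms(5) bc[of x] by simp
  qed
qed

section \<open>Breakpoints, interval lengths and splines on a single piece\<close>

locale breakpoints =
  fixes m :: nat and t d :: "nat \<Rightarrow> real"
  assumes two_le_m: "2 \<le> m"
    and t_less: "\<And>k. 2 \<le> k \<Longrightarrow> k \<le> m \<Longrightarrow> t k < t (k + 1)"
    and d: "\<And>k. 1 \<le> k \<Longrightarrow> k \<le> m - 1 \<Longrightarrow> d k = t (k + 2) - t (k + 1)"
    and d_0: "d 0 = 0" and d_m: "d m = 0"
begin

lemma t_mono: "i \<le> j \<Longrightarrow> 2 \<le> i \<Longrightarrow> j \<le> m + 1 \<Longrightarrow> t i \<le> t j"
proof (induction j rule: dec_induct)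
  case (step j)
  then show ?case using t_less[of j] by auto
qed simp

text \<open>Clipping the index turns the convention \<open>d 0 = 0\<close> into a difference of
  equal breakpoints, in accordance with the repeated end knot. \<open>d_right\<close> does the same
  for \<open>d m = 0\<close>, so the end pieces need no separate treatment later.\<close>

lemma d_left: "k \<le> m - 1 \<Longrightarrow> d k = t (k + 2) - t (max 2 (k + 1))"
  using d[of k] d_0 by (cases "k = 0") (auto simp: numeral_2_eq_2)

lemma d_right: "1 \<le> k \<Longrightarrow> k \<le> m \<Longrightarrow> d k = t (min (m + 1) (k + 2)) - t (k + 1)"
proof (cases "k = m")
  case False
  assume "1 \<le> k" "k \<le> m"
  then have "min (m + 1) (k + 2) = k + 2" "k \<le> m - 1" using False by auto
  then show ?thesis using d[of k] \<open>1 \<le> k\<close> by simp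
qed (use d_m in simp)

lemma d_Suc: "k \<le> m - 2 \<Longrightarrow> d (k + 1) = t (k + 3) - t (k + 2)"
  using d[of "k + 1"] two_le_m by (simp add: numeral_3_eq_3)

lemma t_less': "k \<le> m - 2 \<Longrightarrow> t (k + 2) < t (k + 3)"
  using t_less[of "k + 2"] two_le_m by (simp add: numeral_3_eq_3)

lemma d_pos: "k \<le> m - 2 \<Longrightarrow> 0 < d (k + 1)"
  using d_Suc t_less' by simp

lemma d_nonneg: "k \<le> m \<Longrightarrow> 0 \<le> d k"
  using d_pos[of "k - 1"] d_0 d_m by (cases "k = 0 \<or> k = m") (auto intro: less_imp_le)

lemma d_add_pos: "k \<le> m - 1 \<Longrightarrow> 0 < d k + d (k + 1)"
proof (cases "k \<le> m - 2")
  case True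
  then show ?thesis using d_pos[of k] d_nonneg[of k] by linarith
next
  case False
  assume "k \<le> m - 1"
  then have "k = (m - 2) + 1" "k + 1 \<le> m" using False two_le_m by auto
  then show ?thesis using d_pos[of "m - 2"] d_nonneg[of "k + 1"] by simp
qed

lemma obtain_piece:
  assumes "u \<in> {t 2..t (m + 1)}"
  obtains k where "k \<le> m - 2" "u \<in> {t (k + 2)..t (k + 3)}"
proof -
  have "\<exists>k\<le>j. u \<in> {t (k + 2)..t (k + 3)}" if "u \<in> {t 2..t (j + 3)}" "j \<le> m - 2" for j
    using that
  proof (induction j)
    case 0
    then show ?case by (auto simp: numeral_2_eq_2 numeral_3_eq_3)
  next
    case (Suc j)
    show ?case
    proof (cases "u \<le> t (j + 3)")
      case True
      then show ?thesis using Suc by (auto intro: le_SucI)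
    next
      case False
      then show ?thesis using Suc.prems
        by (intro exI[of _ "Suc j"]) (auto simp: numeral_2_eq_2 numeral_3_eq_3)
    qed
  qed
  moreover have "m - 2 + 3 = m + 1" using two_le_m by simp
  ultimately show thesis using assms that by (metis order_refl)
qed

lemma sorted_clamped_knots:
  assumes "0 < j" "j \<le> e"
  shows "sorted (clamped_knots e j t m)"
  unfolding sorted_iff_nth_mono
proof (intro allI impI)
  fix i i' assume i: "i \<le> i'" "i' < length (clamped_knots e j t m)"
  have "(i + j - e) div j \<le> (i' + j - e) div j" using i by (intro div_le_mono) auto
  then show "clamped_knots e j t m ! i \<le> clamped_knots e j t m ! i'"
    using i assms two_le_m by (auto simp: nth_clamped_knots intro!: t_mono)
qed

text \<open>The right end point of a piece is either the left end point of the next one, where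
  \<open>match\<close> identifies the two values, or the last knot, where the value is a left
  limit.\<close>

lemma spline_eq_bezier_closed:
  fixes c :: "nat \<Rightarrow> 'a::real_normed_vector"
  assumes last: "last \<kappa> = t (m + 1)"
    and half_open: "\<And>k u. k \<le> m - 2 \<Longrightarrow> t (k + 2) \<le> u \<Longrightarrow> u < t (k + 3) \<Longrightarrow>
      spline \<kappa> n N c u = bezier n (C k) ((u - t (k + 2)) / d (k + 1))"
    and match: "\<And>k. k < m - 2 \<Longrightarrow> C k n = C (k + 1) 0"
    and k: "k \<le> m - 2" "u \<in> {t (k + 2)..t (k + 3)}"
  shows "spline \<kappa> n N c u = bezier n (C k) ((u - t (k + 2)) / d (k + 1))"
proof (cases "u < t (k + 3)")
  case True
  then show ?thesis using half_open k by simp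
next
  case False
  then have u: "u = t (k + 3)" using k by simp
  then have 1: "(u - t (k + 2)) / d (k + 1) = 1"
    using d_Suc d_pos k by (metis divide_self less_irrefl)
  show ?thesis
  proof (cases "k = m - 2")
    case True
    let ?g = "\<lambda>u. bezier n (C k) ((u - t (k + 2)) / d (k + 1))"
    have "k + 3 = m + 1" using True two_le_m by simp
    then have ul: "u = last \<kappa>" using last u by metis
    have "spline \<kappa> n N c (last \<kappa>) = ?g (last \<kappa>)"
    proof (rule spline_last_eq[of "t (k + 2)"])
      show "t (k + 2) < last \<kappa>" using t_less'[OF k(1)] ul u by metis
      show "spline \<kappa> n N c v = ?g v" if "t (k + 2) \<le> v" "v < last \<kappa>" for v
        using that half_open k ul u by simp
      have "isCont (\<lambda>u. (u - t (k + 2)) / d (k + 1)) (last \<kappa>)"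
        using d_pos[OF k(1)] by (intro continuous_intros) simp
      then show "isCont ?g (last \<kappa>)"
        by (rule isCont_o2) (rule isCont_bezier)
    qed
    then show ?thesis using ul by simp
  next
    case False
    then have k': "k < m - 2" using k by simp
    have "spline \<kappa> n N c u = bezier n (C (k + 1)) ((u - t (k + 1 + 2)) / d (k + 1 + 1))"
      using k' u t_less'[of "k + 1"]
      by (intro half_open) (simp_all add: numeral_3_eq_3 numeral_2_eq_2)
    then show ?thesis
      using u match[OF k'] 1 by (simp add: bezier_0 bezier_1 numeral_3_eq_3 numeral_2_eq_2)
  qed
qed

text \<open>The value at \<open>t (k + 2)\<close> of a spline of degree \<open>n + 1\<close> with interior knots of multiplicity \<open>n\<close>.\<close>

definition break_coeff :: "nat \<Rightarrow> (nat \<Rightarrow> 'a::real_vector) \<Rightarrow> nat \<Rightarrow> 'a" where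
  "break_coeff n c k = (d k / (d k + d (k + 1))) *\<^sub>R c (n * k + 1)
     + (d (k + 1) / (d k + d (k + 1))) *\<^sub>R c (n * k)"

text \<open>These are the ratios \<alpha> and \<beta> of \<open>bspline_Suc_eq_Bernstein\<close> for
  piece \<open>k\<close>, with the outer knots clipped at the ends. The complements are the other
  weights of \<open>break_coeff\<close> at the two breakpoints of the piece.\<close>

lemma break_ratios:
  assumes "k \<le> m - 2"
  shows "d k / (d k + d (k + 1)) = (t (k + 2) - t (max 2 (k + 1))) / (t (k + 3) - t (max 2 (k + 1)))"
    and "1 - d k / (d k + d (k + 1)) = d (k + 1) / (d k + d (k + 1))"
    and "d (k + 2) / (d (k + 1) + d (k + 2)) =
      (t (min (m + 1) (k + 4)) - t (k + 3)) / (t (min (m + 1) (k + 4)) - t (k + 2))"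
    and "1 - d (k + 2) / (d (k + 1) + d (k + 2)) = d (k + 1) / (d (k + 1) + d (k + 2))"
proof -
  have "k \<le> m - 1" "k + 1 \<le> m - 1" "k + 2 \<le> m" using assms two_le_m by auto
  then have pos: "0 < d k + d (k + 1)" "0 < d (k + 1) + d (k + 2)"
    and dk: "d k = t (k + 2) - t (max 2 (k + 1))"
      "d (k + 2) = t (min (m + 1) (k + 4)) - t (k + 3)"
      "d (k + 1) = t (k + 3) - t (k + 2)"
    using d_add_pos[of k] d_add_pos[of "k + 1"] d_left[of k] d_right[of "k + 2"] d_Suc[OF assms]
    by (simp_all add: eval_nat_numeral)
  show "1 - d k / (d k + d (k + 1)) = d (k + 1) / (d k + d (k + 1))"
    "1 - d (k + 2) / (d (k + 1) + d (k + 2)) = d (k + 1) / (d (k + 1) + d (k + 2))"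
    using pos by (simp_all add: field_simps)
  have e: "d k + d (k + 1) = t (k + 3) - t (max 2 (k + 1))"
    "d (k + 1) + d (k + 2) = t (min (m + 1) (k + 4)) - t (k + 2)" using dk by simp_all
  show "d k / (d k + d (k + 1)) = (t (k + 2) - t (max 2 (k + 1))) / (t (k + 3) - t (max 2 (k + 1)))"
    unfolding e(1) using dk(1) by simp
  show "d (k + 2) / (d (k + 1) + d (k + 2)) =
      (t (min (m + 1) (k + 4)) - t (k + 3)) / (t (min (m + 1) (k + 4)) - t (k + 2))"
    unfolding e(2) using dk(2) by simp
qed

text \<open>On piece \<open>k\<close> the active indices are \<open>n * k\<close> to
  \<open>n * k + n + 1\<close>. Collecting by Bernstein polynomials leaves the inner coefficients
  alone and mixes two at each end; neighbouring pieces share the mixture at their common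
  breakpoint.\<close>

lemma clamped_spline_eq_bezier:
  fixes c :: "nat \<Rightarrow> 'a::real_normed_vector"
  assumes n: "0 < n" and k: "k \<le> m - 2" "u \<in> {t (k + 2)..t (k + 3)}"
  shows "spline (clamped_knots (n + 2) n t m) (n + 1) (n * (m - 1) + 1) c u =
    bezier (n + 1) (\<lambda>l. if l = 0 then break_coeff n c k
        else if l = n + 1 then break_coeff n c (k + 1) else c (n * k + l))
      ((u - t (k + 2)) / d (k + 1))"
proof -
  let ?\<kappa> = "clamped_knots (n + 2) n t m"
  define C where "C k l = (if l = 0 then break_coeff n c k
        else if l = n + 1 then break_coeff n c (k + 1) else c (n * k + l))" for k l
  have len: "length ?\<kappa> = n * (m - 2) + 2 * n + 4" by simp
  have nm: "n * (m - 1) = n * (m - 2) + n"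
    using two_le_m by (metis Suc_1 Suc_diff_Suc Suc_le_lessD diff_Suc_1 add.commute mult_Suc_right)
  \<comment> \<open>Here \<open>e - j\<close> is 2, and the truncated \<open>i - 2\<close> keeps the
    indices 0 and 1 in the first block.\<close>
  have knot: "?\<kappa> ! i = t (min (m + 1) (2 + (i - 2) div n))" if "i < length ?\<kappa>" for i
    using that n two_le_m by (subst nth_clamped_knots) simp_all
  have sorted: "sorted ?\<kappa>" using n by (intro sorted_clamped_knots) auto
  have last: "last ?\<kappa> = t (m + 1)" by (simp add: last_clamped_knots)
  have "spline ?\<kappa> (n + 1) (n * (m - 1) + 1) c u = bezier (n + 1) (C k) ((u - t (k + 2)) / d (k + 1))"
  proof (rule spline_eq_bezier_closed[OF last _ _ k])
    show "C k (n + 1) = C (k + 1) 0" if "k < m - 2" for k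
      using n by (simp add: C_def)
    fix k u assume k: "k \<le> m - 2" and u: "t (k + 2) \<le> u" "u < t (k + 3)"
    let ?q = "n * k" and ?s = "n * k + n + 1"
    let ?x = "t (max 2 (k + 1))" and ?y = "t (min (m + 1) (k + 4))"
    let ?\<alpha> = "d k / (d k + d (k + 1))" and ?\<beta> = "d (k + 2) / (d (k + 1) + d (k + 2))"
    have nk: "n * k \<le> n * (m - 2)" using k by simp
    have km: "k + 2 \<le> m + 1" "k + 3 \<le> m + 1" using k two_le_m by auto
    have left: "?\<kappa> ! i = t (k + 2)" if "?q + 2 \<le> i" "i \<le> ?s" for i
    proof -
      have "(i - 2) div n = k"
        using that n by (intro div_nat_eqI) auto
      moreover have "i < length ?\<kappa>" using that nk len by linarith
      moreover have "2 + k = k + 2" by simp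
      ultimately show ?thesis using km by (simp only: knot min.absorb2)
    qed
    have right: "?\<kappa> ! i = t (k + 3)" if "?s < i" "i \<le> ?s + n" for i
    proof -
      have "(i - 2) div n = k + 1"
        using that n by (intro div_nat_eqI) auto
      moreover have "i < length ?\<kappa>" using that nk len by linarith
      moreover have "2 + (k + 1) = k + 3" by simp
      ultimately show ?thesis using km by (simp only: knot min.absorb2)
    qed
    have x: "?x = ?\<kappa> ! (?q + 1)"
    proof (cases k)
      case (Suc k')
      have "(?q + 1 - 2) div n = k'"
        using n Suc by (intro div_nat_eqI) auto
      moreover have "?q + 1 < length ?\<kappa>" using nk len by linarith
      moreover have "min (m + 1) (2 + k') = max 2 (k + 1)" using km Suc by simp
      ultimately show ?thesis by (simp only: knot)
    next
      \<comment> \<open>The subtraction truncates, so the outer knot is \<open>t 2\<close>, which is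
        also the left end of the piece; the ratio \<alpha> is then 0.\<close>
      case 0
      then have "(?q + 1 - 2) div n = 0" "?q + 1 < length ?\<kappa>"
        "min (m + 1) (2 + 0) = max 2 (k + 1)"
        using nk len two_le_m by auto
      then show ?thesis by (simp only: knot)
    qed
    have "(?q + 2 * n + 2 - 2) div n = k + 2"
      using n by (intro div_nat_eqI) (auto simp: algebra_simps)
    moreover have "?q + 2 * n + 2 < length ?\<kappa>" using nk len by linarith
    moreover have "2 + (k + 2) = k + 4" by simp
    ultimately have y: "?y = ?\<kappa> ! (?q + 2 * n + 2)"
      by (simp only: knot)
    have s: "?\<kappa> ! ?s = t (k + 2)" "?\<kappa> ! Suc ?s = t (k + 3)"
      using n by (intro left right; simp)+
    have N: "bspline ?\<kappa> (Suc n) (?q + l) u =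
      (if l = 0 then 1 - ?\<alpha> else if l = n + 1 then 1 - ?\<beta> else 1) *
          Bernstein (n + 1) l ((u - t (k + 2)) / (t (k + 3) - t (k + 2)))
      + (if l = 1 then ?\<alpha> * Bernstein (n + 1) 0 ((u - t (k + 2)) / (t (k + 3) - t (k + 2))) else 0)
      + (if l = n then ?\<beta> * Bernstein (n + 1) (n + 1) ((u - t (k + 2)) / (t (k + 3) - t (k + 2))) else 0)"
      if "l \<le> n + 1" for l
    proof -
      have "?q + 2 * n + 2 < length ?\<kappa>" "?q + l + n + 2 < length ?\<kappa>"
        using that nk len by linarith+
      then show ?thesis using that u s n
      by (intro bspline_Suc_eq_Bernstein[OF sorted n refl _ _ _ left right x y
            break_ratios(1,3)[OF k] refl]) auto
    qed
    have "u < t (m + 1)" using u(2) t_mono[of "k + 3" "m + 1"] km by simp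
    then have "spline ?\<kappa> (n + 1) (n * (m - 1) + 1) c u
        = (\<Sum>i=0..n * (m - 1) + 1. bspline ?\<kappa> (n + 1) i u *\<^sub>R c i)"
      using last by (intro spline_eq_sum_bspline) auto
    also have "\<dots> = (\<Sum>l\<le>n + 1. bspline ?\<kappa> (n + 1) (?q + l) u *\<^sub>R c (?q + l))"
      using nk len nm u s by (intro sum_bspline_span[OF sorted, of ?s]) auto
    also have "\<dots> = (\<Sum>l\<le>Suc n.
      ((if l = 0 then 1 - ?\<alpha> else if l = n + 1 then 1 - ?\<beta> else 1) *
          Bernstein (n + 1) l ((u - t (k + 2)) / (t (k + 3) - t (k + 2)))
      + (if l = 1 then ?\<alpha> * Bernstein (n + 1) 0 ((u - t (k + 2)) / (t (k + 3) - t (k + 2))) else 0)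
      + (if l = n then ?\<beta> * Bernstein (n + 1) (n + 1) ((u - t (k + 2)) / (t (k + 3) - t (k + 2))) else 0))
      *\<^sub>R c (?q + l))"
      using N by (intro sum.cong) auto
    also have "\<dots> = bezier (n + 1) (C k) ((u - t (k + 2)) / d (k + 1))"
      unfolding sum_break_eq_bezier[OF n]
      unfolding d_Suc[OF k, symmetric] Suc_eq_plus1 break_ratios(2,4)[OF k]
      by (rule bezier_cong) (use n in \<open>auto simp: C_def break_coeff_def ac_simps\<close>)
    finally show "spline ?\<kappa> (n + 1) (n * (m - 1) + 1) c u
        = bezier (n + 1) (C k) ((u - t (k + 2)) / d (k + 1))" .
  qed
  moreover have "C k = (\<lambda>l. if l = 0 then break_coeff n c k
      else if l = n + 1 then break_coeff n c (k + 1) else c (n * k + l))"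
    by (rule ext) (rule C_def)
  ultimately show ?thesis by simp
qed

text \<open>The value at \<open>t (k + 2)\<close> of a quintic spline with triple interior knots.\<close>

definition quintic_break_coeff :: "(nat \<Rightarrow> 'a::real_vector) \<Rightarrow> nat \<Rightarrow> 'a" where
  "quintic_break_coeff c k =
     (let \<alpha> = d k / (d k + d (k + 1))
      in \<alpha>\<^sup>2 *\<^sub>R c (3 * k + 2) + (2 * \<alpha> * (1 - \<alpha>)) *\<^sub>R c (3 * k + 1) + (1 - \<alpha>)\<^sup>2 *\<^sub>R c (3 * k))"

text \<open>Being two steps above degree 3, the quintic has two mixed control points at each end of
  a piece. Next to a breakpoint, the mixture on its right uses coefficients shifted by one against
  the mixture on its left.\<close>

lemma clamped_quintic_spline_eq_bezier:
  fixes c :: "nat \<Rightarrow> 'a::real_normed_vector"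
  assumes k: "k \<le> m - 2" "u \<in> {t (k + 2)..t (k + 3)}"
  shows "spline (clamped_knots 6 3 t m) 5 (3 * m - 1) c u =
    bezier 5 (nth [quintic_break_coeff c k, break_coeff 3 (\<lambda>i. c (i + 1)) k, c (3 * k + 2),
        c (3 * k + 3), break_coeff 3 c (k + 1), quintic_break_coeff c (k + 1)])
      ((u - t (k + 2)) / d (k + 1))"
proof -
  let ?\<kappa> = "clamped_knots 6 3 t m"
  define C where "C k = nth [quintic_break_coeff c k, break_coeff 3 (\<lambda>i. c (i + 1)) k, c (3 * k + 2),
        c (3 * k + 3), break_coeff 3 c (k + 1), quintic_break_coeff c (k + 1)]" for k
  have len: "length ?\<kappa> = 3 * m + 6" using two_le_m by simp
  have knot: "?\<kappa> ! i = t (min (m + 1) (2 + (i - 3) div 3))" if "i < length ?\<kappa>" for i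
    using that two_le_m by (subst nth_clamped_knots) simp_all
  have sorted: "sorted ?\<kappa>" by (intro sorted_clamped_knots) auto
  have last: "last ?\<kappa> = t (m + 1)" by (simp add: last_clamped_knots)
  have "spline ?\<kappa> 5 (3 * m - 1) c u = bezier 5 (C k) ((u - t (k + 2)) / d (k + 1))"
  proof (rule spline_eq_bezier_closed[OF last _ _ k])
    show "C k 5 = C (k + 1) 0" if "k < m - 2" for k
      by (simp add: C_def)
    fix k u assume k: "k \<le> m - 2" and u: "t (k + 2) \<le> u" "u < t (k + 3)"
    let ?q = "3 * k"
    let ?x = "t (max 2 (k + 1))" and ?y = "t (min (m + 1) (k + 4))"
    let ?\<alpha> = "d k / (d k + d (k + 1))" and ?\<beta> = "d (k + 2) / (d (k + 1) + d (k + 2))"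
    let ?w = "(u - t (k + 2)) / (t (k + 3) - t (k + 2))"
    have km: "k + 2 \<le> m" "k + 3 \<le> m + 1" using k two_le_m by auto
    have knot': "?\<kappa> ! i = t j" if "i \<le> ?q + 10" "(i - 3) div 3 = j'" "min (m + 1) (2 + j') = j" for i j j'
      using that knot[of i] len km by simp
    \<comment> \<open>The truncated \<open>k - 1\<close> is intended: for \<open>k = 0\<close> it
      yields \<open>t 2\<close>, in agreement with \<open>max 2 (k + 1)\<close>.\<close>
    have kn1: "?\<kappa> ! (?q + 1) = ?x"
      by (rule knot'[of _ "k - 1"]; use km in \<open>cases k; simp\<close>)
    have kn2: "?\<kappa> ! (?q + 2) = ?x"
      by (rule knot'[of _ "k - 1"]; use km in \<open>cases k; simp\<close>)
    have kn3: "?\<kappa> ! (?q + 3) = t (k + 2)"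
      by (rule knot'[of _ "k"]; use km in \<open>simp\<close>)
    have kn4: "?\<kappa> ! (?q + 4) = t (k + 2)"
      by (rule knot'[of _ "k"]; use km in \<open>simp\<close>)
    have kn5: "?\<kappa> ! (?q + 5) = t (k + 2)"
      by (rule knot'[of _ "k"]; use km in \<open>simp\<close>)
    have kn6: "?\<kappa> ! (?q + 6) = t (k + 3)"
      by (rule knot'[of _ "k + 1"]; use km in \<open>simp\<close>)
    have kn7: "?\<kappa> ! (?q + 7) = t (k + 3)"
      by (rule knot'[of _ "k + 1"]; use km in \<open>simp\<close>)
    have kn8: "?\<kappa> ! (?q + 8) = t (k + 3)"
      by (rule knot'[of _ "k + 1"]; use km in \<open>simp\<close>)
    have kn9: "?\<kappa> ! (?q + 9) = ?y"
      by (rule knot'[of _ "k + 2"]; use km in \<open>simp\<close>)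
    have kn10: "?\<kappa> ! (?q + 10) = ?y"
      by (rule knot'[of _ "k + 2"]; use km in \<open>simp\<close>)
    note kn = kn1 kn2 kn3 kn4 kn5 kn6 kn7 kn8 kn9 kn10
    note N = bspline_quintic_eq_Bernstein[OF sorted _ _ _ kn break_ratios(1,3)[OF k] refl, of u]
    have "u < t (m + 1)" using u(2) t_mono[of "k + 3" "m + 1"] km by simp
    then have "spline ?\<kappa> 5 (3 * m - 1) c u
        = (\<Sum>i=0..3 * m - 1. bspline ?\<kappa> 5 i u *\<^sub>R c i)"
      using last by (intro spline_eq_sum_bspline) auto
    also have "\<dots> = (\<Sum>l\<le>5. bspline ?\<kappa> 5 (?q + l) u *\<^sub>R c (?q + l))"
      using len u kn5 kn6 km
      by (intro sum_bspline_span[OF sorted, of "?q + 5"]) (simp_all add: add.commute[of _ "?q"])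
    also have "\<dots> = bspline ?\<kappa> 5 ?q u *\<^sub>R c ?q + bspline ?\<kappa> 5 (?q + 1) u *\<^sub>R c (?q + 1)
        + bspline ?\<kappa> 5 (?q + 2) u *\<^sub>R c (?q + 2) + bspline ?\<kappa> 5 (?q + 3) u *\<^sub>R c (?q + 3)
        + bspline ?\<kappa> 5 (?q + 4) u *\<^sub>R c (?q + 4) + bspline ?\<kappa> 5 (?q + 5) u *\<^sub>R c (?q + 5)"
      by (simp add: eval_nat_numeral)
    also have "\<dots> = bezier 5 (C k) ?w"
    proof -
      have "bezier 5 f w = Bernstein 5 0 w *\<^sub>R f 0 + Bernstein 5 1 w *\<^sub>R f 1
        + Bernstein 5 2 w *\<^sub>R f 2 + Bernstein 5 3 w *\<^sub>R f 3
        + Bernstein 5 4 w *\<^sub>R f 4 + Bernstein 5 5 w *\<^sub>R f 5" for f :: "nat \<Rightarrow> 'a" and w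
        unfolding bezier_def by (simp add: eval_nat_numeral)
      then have b: "bezier 5 (C k) ?w = Bernstein 5 0 ?w *\<^sub>R quintic_break_coeff c k
        + Bernstein 5 1 ?w *\<^sub>R break_coeff 3 (\<lambda>i. c (i + 1)) k
        + Bernstein 5 2 ?w *\<^sub>R c (3 * k + 2) + Bernstein 5 3 ?w *\<^sub>R c (3 * k + 3)
        + Bernstein 5 4 ?w *\<^sub>R break_coeff 3 c (k + 1)
        + Bernstein 5 5 ?w *\<^sub>R quintic_break_coeff c (k + 1)"
        by (simp add: C_def)
      have \<beta>: "d (k + 1) / (d (k + 1) + d (k + 1 + 1)) = 1 - ?\<beta>"
        "d (k + 1 + 1) / (d (k + 1) + d (k + 1 + 1)) = ?\<beta>"
        using break_ratios(4)[OF k] by simp_all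
      have e: "break_coeff 3 (\<lambda>i. c (i + 1)) k = ?\<alpha> *\<^sub>R c (?q + 2) + (1 - ?\<alpha>) *\<^sub>R c (?q + 1)"
        "break_coeff 3 c (k + 1) = (1 - ?\<beta>) *\<^sub>R c (?q + 4) + ?\<beta> *\<^sub>R c (?q + 3)"
        unfolding break_coeff_def break_ratios(2)[OF k] \<beta> by (simp_all add: ac_simps)
      have idx: "3 * (k + 1) + 2 = ?q + 5" "3 * (k + 1) + 1 = ?q + 4" "3 * (k + 1) = ?q + 3"
        "?q + 3 + 2 = ?q + 5" "?q + 3 + 1 = ?q + 4" "1 - (1 - x) = x" for x :: real
        by simp_all
      have e': "quintic_break_coeff c (k + 1) = (1 - ?\<beta>)\<^sup>2 *\<^sub>R c (?q + 5)
          + (2 * (1 - ?\<beta>) * ?\<beta>) *\<^sub>R c (?q + 4) + ?\<beta>\<^sup>2 *\<^sub>R c (?q + 3)"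
        "quintic_break_coeff c k = ?\<alpha>\<^sup>2 *\<^sub>R c (?q + 2)
          + (2 * ?\<alpha> * (1 - ?\<alpha>)) *\<^sub>R c (?q + 1) + (1 - ?\<alpha>)\<^sup>2 *\<^sub>R c ?q"
        unfolding quintic_break_coeff_def Let_def \<beta> idx by (rule refl)+
      have "t (k + 2) \<le> u" "u < t (k + 3)" "?q + 11 < length ?\<kappa>" using u len km by auto
      note N = N[unfolded kn5 kn6, OF this]
      show ?thesis unfolding b e e' N
        by (simp add: scaleR_add_left scaleR_add_right ac_simps)
    qed
    also have "\<dots> = bezier 5 (C k) ((u - t (k + 2)) / d (k + 1))"
      unfolding d_Suc[OF k] ..
    finally show "spline ?\<kappa> 5 (3 * m - 1) c u
        = bezier 5 (C k) ((u - t (k + 2)) / d (k + 1))" .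
  qed
  then show ?thesis by (simp add: C_def)
qed

end

subsection \<open>Products and degree elevation\<close>

lemma bezier_4: "bezier 4 c w = Bernstein 4 0 w *\<^sub>R c 0 + Bernstein 4 1 w *\<^sub>R c 1
    + Bernstein 4 2 w *\<^sub>R c 2 + Bernstein 4 3 w *\<^sub>R c 3 + Bernstein 4 4 w *\<^sub>R c 4"
  unfolding bezier_def by (simp add: eval_nat_numeral)

lemma bezier_5: "bezier 5 c w = Bernstein 5 0 w *\<^sub>R c 0 + Bernstein 5 1 w *\<^sub>R c 1
    + Bernstein 5 2 w *\<^sub>R c 2 + Bernstein 5 3 w *\<^sub>R c 3 + Bernstein 5 4 w *\<^sub>R c 4
    + Bernstein 5 5 w *\<^sub>R c 5"
  unfolding bezier_def by (simp add: eval_nat_numeral)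

lemma bezier_9: "bezier 9 c w = Bernstein 9 0 w *\<^sub>R c 0 + Bernstein 9 1 w *\<^sub>R c 1
    + Bernstein 9 2 w *\<^sub>R c 2 + Bernstein 9 3 w *\<^sub>R c 3 + Bernstein 9 4 w *\<^sub>R c 4
    + Bernstein 9 5 w *\<^sub>R c 5 + Bernstein 9 6 w *\<^sub>R c 6 + Bernstein 9 7 w *\<^sub>R c 7
    + Bernstein 9 8 w *\<^sub>R c 8 + Bernstein 9 9 w *\<^sub>R c 9"
  unfolding bezier_def by (simp add: eval_nat_numeral)

lemma of_real_bezier: "complex_of_real (bezier n c w) = bezier n (\<lambda>l. complex_of_real (c l)) w"
  by (simp add: bezier_def scaleR_conv_of_real)

lemma bezier_diff_mult:
  fixes c c' :: "nat \<Rightarrow> complex"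
  shows "bezier n (\<lambda>l. c l - x * c' l) w = bezier n c w - x * bezier n c' w"
  by (simp add: bezier_def scaleR_diff_right sum_subtractf sum_distrib_left)

lemma bezier_4_homogeneous:
  fixes c :: "nat \<Rightarrow> complex"
  assumes "x = complex_of_real w" "y = complex_of_real (1 - w)"
  shows "bezier 4 c w = y^4 * c 0 + 4 * x * y^3 * c 1 + 6 * x^2 * y^2 * c 2 + 4 * x^3 * y * c 3 + x^4 * c 4"
  unfolding bezier_4 Bernstein_def scaleR_conv_of_real assms of_real_mult of_real_power
  by (simp add: eval_nat_numeral)

lemma bezier_5_homogeneous:
  fixes c :: "nat \<Rightarrow> complex"
  assumes "x = complex_of_real w" "y = complex_of_real (1 - w)"
  shows "bezier 5 c w = y^5 * c 0 + 5 * x * y^4 * c 1 + 10 * x^2 * y^3 * c 2 + 10 * x^3 * y^2 * c 3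
    + 5 * x^4 * y * c 4 + x^5 * c 5"
  unfolding bezier_5 Bernstein_def scaleR_conv_of_real assms of_real_mult of_real_power
  by (simp add: eval_nat_numeral)

lemma bezier_9_homogeneous:
  fixes c :: "nat \<Rightarrow> complex"
  assumes "x = complex_of_real w" "y = complex_of_real (1 - w)"
  shows "bezier 9 c w = y^9 * c 0 + 9 * x * y^8 * c 1 + 36 * x^2 * y^7 * c 2 + 84 * x^3 * y^6 * c 3
    + 126 * x^4 * y^5 * c 4 + 126 * x^5 * y^4 * c 5 + 84 * x^6 * y^3 * c 6 + 36 * x^7 * y^2 * c 7
    + 9 * x^8 * y * c 8 + x^9 * c 9"
proof -
  have ch: "9 choose 2 = (36::nat)" "9 choose 3 = (84::nat)" "9 choose 4 = (126::nat)"
    "9 choose 5 = (126::nat)" "9 choose 6 = (84::nat)" "9 choose 7 = (36::nat)"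
    "9 choose 8 = (9::nat)" "9 choose 0 = (1::nat)" "9 choose 1 = (9::nat)" "9 choose 9 = (1::nat)"
    by (simp_all add: eval_nat_numeral)
  show ?thesis
    unfolding bezier_9 Bernstein_def scaleR_conv_of_real assms of_real_mult of_real_power ch
    by simp
qed

text \<open>The factor of \<open>bj * si\<close> is
  \<open>(4 choose i) * (5 choose j) / (9 choose (i + j))\<close>, from multiplying the Bernstein
  polynomials.\<close>

lemma bezier_mult_4_5:
  fixes s0 b0 :: complex
  shows "bezier 4 (nth [s0, s1, s2, s3, s4]) w * bezier 5 (nth [b0, b1, b2, b3, b4, b5]) w =
    bezier 9 (nth [b0 * s0, 5/9 * b1 * s0 + 4/9 * b0 * s1,
      5/18 * b2 * s0 + 5/9 * b1 * s1 + 1/6 * b0 * s2,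
      5/42 * b3 * s0 + 10/21 * b2 * s1 + 5/14 * b1 * s2 + 1/21 * b0 * s3,
      5/126 * b4 * s0 + 20/63 * b3 * s1 + 10/21 * b2 * s2 + 10/63 * b1 * s3 + 1/126 * b0 * s4,
      1/126 * b5 * s0 + 10/63 * b4 * s1 + 10/21 * b3 * s2 + 20/63 * b2 * s3 + 5/126 * b1 * s4,
      1/21 * b5 * s1 + 5/14 * b4 * s2 + 10/21 * b3 * s3 + 5/42 * b2 * s4,
      1/6 * b5 * s2 + 5/9 * b4 * s3 + 5/18 * b3 * s4,
      4/9 * b5 * s3 + 5/9 * b4 * s4, b5 * s4]) w"
proof -
  \<comment> \<open>With \<open>w\<close> and \<open>1 - w\<close> kept as separate symbols, the
    claim is a homogeneous identity of degree 9 that holds monomial by monomial, without using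
    \<open>x + y = 1\<close>.\<close>
  define x y where "x = complex_of_real w" and "y = complex_of_real (1 - w)"
  show ?thesis
    unfolding bezier_4_homogeneous[OF x_def y_def] bezier_5_homogeneous[OF x_def y_def]
      bezier_9_homogeneous[OF x_def y_def]
    by (simp add: algebra_simps eval_nat_numeral)
qed

text \<open>Degree elevation is multiplication by the quintic Bezier form of the constant 1.\<close>

lemma bezier_elevate_4_9:
  fixes s0 :: complex
  shows "bezier 4 (nth [s0, s1, s2, s3, s4]) w =
    bezier 9 (nth [s0, 5/9 * s0 + 4/9 * s1,
      5/18 * s0 + 5/9 * s1 + 1/6 * s2,
      5/42 * s0 + 10/21 * s1 + 5/14 * s2 + 1/21 * s3,
      5/126 * s0 + 20/63 * s1 + 10/21 * s2 + 10/63 * s3 + 1/126 * s4,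
      1/126 * s0 + 10/63 * s1 + 10/21 * s2 + 20/63 * s3 + 5/126 * s4,
      1/21 * s1 + 5/14 * s2 + 10/21 * s3 + 5/42 * s4,
      1/6 * s2 + 5/9 * s3 + 5/18 * s4,
      4/9 * s3 + 5/9 * s4, s4]) w"
proof -
  have "bezier 5 (nth [1, 1, 1, 1, 1, 1 :: complex]) w = (complex_of_real w + complex_of_real (1 - w)) ^ 5"
    unfolding bezier_5_homogeneous[OF refl refl] by (simp add: algebra_simps eval_nat_numeral)
  then show ?thesis
    using bezier_mult_4_5[of s0 s1 s2 s3 s4 w 1 1 1 1 1 1] by simp
qed

section \<open>Quartic and nonic pieces, and the derivative of the clamped quintic\<close>

context breakpoints
begin

lemma clamped_quartic_spline_eq_bezier:
  fixes c :: "nat \<Rightarrow> 'a::real_normed_vector"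
  assumes k: "k \<le> m - 2" "u \<in> {t (k + 2)..t (k + 3)}"
  shows "spline (clamped_knots 5 3 t m) 4 (3 * m - 2) c u =
    bezier 4 (nth [break_coeff 3 c k, c (3 * k + 1), c (3 * k + 2), c (3 * k + 3), break_coeff 3 c (k + 1)])
      ((u - t (k + 2)) / d (k + 1))"
proof -
  have "3 * (m - 1) + 1 = 3 * m - 2" using two_le_m by simp
  then show ?thesis
    using clamped_spline_eq_bezier[OF _ k, of 3 c] by (simp add: bezier_4)
qed

lemma clamped_nonic_spline_eq_bezier:
  fixes c :: "nat \<Rightarrow> 'a::real_normed_vector"
  assumes k: "k \<le> m - 2" "u \<in> {t (k + 2)..t (k + 3)}"
  shows "spline (clamped_knots 10 8 t m) 9 (8 * m - 7) c u =
    bezier 9 (nth [break_coeff 8 c k, c (8 * k + 1), c (8 * k + 2), c (8 * k + 3), c (8 * k + 4),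
      c (8 * k + 5), c (8 * k + 6), c (8 * k + 7), c (8 * (k + 1)), break_coeff 8 c (k + 1)])
      ((u - t (k + 2)) / d (k + 1))"
proof -
  have "8 * (m - 1) + 1 = 8 * m - 7" using two_le_m by simp
  then show ?thesis
    using clamped_spline_eq_bezier[OF _ k, of 8 c] by (simp add: bezier_9 ac_simps)
qed

lemma nth_quartic_knots:
  "i < 3 * m + 4 \<Longrightarrow> clamped_knots 5 3 t m ! i = t (min (m + 1) (2 + (i - 2) div 3))"
  using two_le_m by (subst nth_clamped_knots) simp_all

text \<open>These are the lengths in the recursion for \<open>r\<close>. The first two cover both
  intervals meeting at \<open>t (k + 2)\<close>, one of which is degenerate at an end breakpoint;
  the third covers a single interval.\<close>

lemma quartic_knot_diff:
  assumes "k \<le> m - 1"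
  shows "clamped_knots 5 3 t m ! (3 * k + 5) - clamped_knots 5 3 t m ! (3 * k) = d k + d (k + 1)"
    and "clamped_knots 5 3 t m ! (3 * k + 6) - clamped_knots 5 3 t m ! (3 * k + 1) = d k + d (k + 1)"
    and "k \<le> m - 2 \<Longrightarrow>
      clamped_knots 5 3 t m ! (3 * k + 7) - clamped_knots 5 3 t m ! (3 * k + 2) = d (k + 1)"
proof -
  let ?\<kappa> = "clamped_knots 5 3 t m"
  have km: "k + 1 \<le> m" using assms two_le_m by simp
  have knot: "?\<kappa> ! i = t j" if "i \<le> 3 * k + 6" "(i - 2) div 3 = j'" "min (m + 1) (2 + j') = j" for i j j'
    using that nth_quartic_knots[of i] km by simp
  have "?\<kappa> ! (3 * k + 5) = t (min (m + 1) (k + 3))" "?\<kappa> ! (3 * k + 6) = t (min (m + 1) (k + 3))"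
    by (rule knot[of _ "k + 1"]; simp)+
  moreover have "?\<kappa> ! (3 * k) = t (max 2 (k + 1))" "?\<kappa> ! (3 * k + 1) = t (max 2 (k + 1))"
    by (rule knot[of _ "k - 1"]; use km two_le_m in \<open>cases k; simp\<close>)+
  moreover have "d k + d (k + 1) = t (min (m + 1) (k + 3)) - t (max 2 (k + 1))"
  proof -
    have "k + 1 + 2 = k + 3" "k + 1 + 1 = k + 2" by simp_all
    then show ?thesis using d_left[OF assms] d_right[of "k + 1"] km by (metis add_diff_eq diff_add_cancel le_add2 add.commute)
  qed
  ultimately show "?\<kappa> ! (3 * k + 5) - ?\<kappa> ! (3 * k) = d k + d (k + 1)"
    "?\<kappa> ! (3 * k + 6) - ?\<kappa> ! (3 * k + 1) = d k + d (k + 1)"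
    by simp_all
  assume k: "k \<le> m - 2"
  have knot': "?\<kappa> ! i = t j" if "(i - 2) div 3 = j'" "i \<le> 3 * k + 7" "2 + j' = j" for i j j'
    using that nth_quartic_knots[of i] k two_le_m by simp
  have "?\<kappa> ! (3 * k + 7) = t (k + 3)" "?\<kappa> ! (3 * k + 2) = t (k + 2)"
    by (rule knot'[of _ "k + 1"]; simp) (rule knot'[of _ k]; simp)
  then show "?\<kappa> ! (3 * k + 7) - ?\<kappa> ! (3 * k + 2) = d (k + 1)"
    using d_Suc[OF k] by simp
qed

text \<open>These are the steps between consecutive quintic control points around breakpoint
  \<open>k\<close>. Each is a quartic control point times a fifth of the length of the piece it lies
  in, \<open>d (k + 1)\<close> on the right and \<open>d k\<close> on the left, as the derivative of
  a quintic Bezier form requires.\<close>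

lemma quintic_break_differences:
  fixes p r :: "nat \<Rightarrow> 'a::real_normed_vector"
  assumes k: "k \<le> m - 1"
    and r: "r (3 * k + 1) = r (3 * k) + ((d k + d (k + 1)) / 5) *\<^sub>R p (3 * k)"
      "r (3 * k + 2) = r (3 * k + 1) + ((d k + d (k + 1)) / 5) *\<^sub>R p (3 * k + 1)"
  shows "break_coeff 3 (\<lambda>i. r (i + 1)) k - quintic_break_coeff r k = (d (k + 1) / 5) *\<^sub>R break_coeff 3 p k"
    and "quintic_break_coeff r k - break_coeff 3 r k = (d k / 5) *\<^sub>R break_coeff 3 p k"
    and "r (3 * k + 2) - break_coeff 3 (\<lambda>i. r (i + 1)) k = (d (k + 1) / 5) *\<^sub>R p (3 * k + 1)"
    and "break_coeff 3 r k - r (3 * k) = (d k / 5) *\<^sub>R p (3 * k)"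
proof -
  \<comment> \<open>The two lengths become \<open>\<alpha> * e\<close> and
    \<open>(1 - \<alpha>) * e\<close> up to the common factor 5, so the identities are polynomial in
    \<alpha> and \<open>e\<close>.\<close>
  define e \<alpha> where "e = (d k + d (k + 1)) / 5" and "\<alpha> = d k / (d k + d (k + 1))"
  have pos: "0 < d k + d (k + 1)" using d_add_pos[OF k] .
  have \<alpha>': "d (k + 1) / (d k + d (k + 1)) = 1 - \<alpha>"
    unfolding \<alpha>_def using pos by (simp add: field_simps)
  have e1: "d (k + 1) / 5 = (1 - \<alpha>) * e" and e0: "d k / 5 = \<alpha> * e"
    unfolding \<alpha>'[symmetric] unfolding \<alpha>_def e_def using pos by simp_all
  have r': "r (3 * k + 1) = r (3 * k) + e *\<^sub>R p (3 * k)"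
      "r (3 * k + 2) = r (3 * k) + e *\<^sub>R p (3 * k) + e *\<^sub>R p (3 * k + 1)"
    using r by (simp_all add: e_def)
  have b: "break_coeff 3 c k = \<alpha> *\<^sub>R c (3 * k + 1) + (1 - \<alpha>) *\<^sub>R c (3 * k)" for c :: "nat \<Rightarrow> 'a"
    unfolding break_coeff_def \<alpha>' unfolding \<alpha>_def ..
  have "2 * \<alpha> * (1 - \<alpha>) = \<alpha> * (1 - \<alpha>) + \<alpha> * (1 - \<alpha>)" by simp
  then have b': "quintic_break_coeff r k = (\<alpha> * \<alpha>) *\<^sub>R r (3 * k + 2)
      + (\<alpha> * (1 - \<alpha>)) *\<^sub>R r (3 * k + 1) + (\<alpha> * (1 - \<alpha>)) *\<^sub>R r (3 * k + 1)
      + ((1 - \<alpha>) * (1 - \<alpha>)) *\<^sub>R r (3 * k)"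
    unfolding quintic_break_coeff_def Let_def \<alpha>_def[symmetric] power2_eq_square
    by (simp only: scaleR_add_left add.assoc)
  have i: "3 * k + 1 + 1 = 3 * k + 2" by simp
  show "break_coeff 3 (\<lambda>i. r (i + 1)) k - quintic_break_coeff r k = (d (k + 1) / 5) *\<^sub>R break_coeff 3 p k"
    unfolding b b' i e1 r'
    by (simp add: algebra_simps; simp only: mult_2_right scaleR_add_left)
  show "quintic_break_coeff r k - break_coeff 3 r k = (d k / 5) *\<^sub>R break_coeff 3 p k"
    unfolding b b' e0 r'
    by (simp add: algebra_simps; simp only: mult_2_right scaleR_add_left)
  show "r (3 * k + 2) - break_coeff 3 (\<lambda>i. r (i + 1)) k = (d (k + 1) / 5) *\<^sub>R p (3 * k + 1)"
    unfolding b i e1 r' by (simp add: algebra_simps)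
  show "break_coeff 3 r k - r (3 * k) = (d k / 5) *\<^sub>R p (3 * k)"
    unfolding b e0 r' by (simp add: algebra_simps)
qed

text \<open>On each closed piece the factor \<open>d (k + 1)\<close> from the control point
  differences cancels the \<open>1 / d (k + 1)\<close> of the chain rule. At an interior breakpoint
  both one-sided derivatives are the value of one quartic spline, so the pieces can be
  glued.\<close>

lemma has_vector_derivative_clamped_quintic_spline:
  fixes p r :: "nat \<Rightarrow> 'a::real_normed_vector"
  defines "\<nu> \<equiv> clamped_knots 5 3 t m"
  assumes r: "\<And>i. i \<le> 3 * m - 2 \<Longrightarrow> r (i + 1) = r i + ((\<nu> ! (i + 5) - \<nu> ! i) / 5) *\<^sub>R p i"
    and u: "u \<in> {t 2..t (m + 1)}"
  shows "(spline (clamped_knots 6 3 t m) 5 (3 * m - 1) r has_vector_derivative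
    spline \<nu> 4 (3 * m - 2) p u) (at u within {t 2..t (m + 1)})"
proof -
  let ?R = "spline (clamped_knots 6 3 t m) 5 (3 * m - 1) r"
  have idx: "3 * k + 1 + 1 = 3 * k + 2" "3 * k + 1 + 5 = 3 * k + 6"
    "3 * k + 2 + 1 = 3 * k + 3" "3 * k + 2 + 5 = 3 * k + 7" for k :: nat
    by simp_all
  have r0: "r (3 * k + 1) = r (3 * k) + ((d k + d (k + 1)) / 5) *\<^sub>R p (3 * k)"
    and r1: "r (3 * k + 2) = r (3 * k + 1) + ((d k + d (k + 1)) / 5) *\<^sub>R p (3 * k + 1)"
    if "k \<le> m - 1" for k
    using that two_le_m r[of "3 * k", unfolded \<nu>_def quartic_knot_diff(1)[OF that]]
      r[of "3 * k + 1", unfolded \<nu>_def idx quartic_knot_diff(2)[OF that]]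
    by simp_all
  have r2: "r (3 * k + 3) = r (3 * k + 2) + (d (k + 1) / 5) *\<^sub>R p (3 * k + 2)" if "k \<le> m - 2" for k
  proof -
    have km: "k \<le> m - 1" using that by simp
    show ?thesis
      using that two_le_m r[of "3 * k + 2", unfolded \<nu>_def idx quartic_knot_diff(3)[OF km that]]
      by simp
  qed
  have piece: "(?R has_vector_derivative spline \<nu> 4 (3 * m - 2) p u) (at u within {t (k + 2)..t (k + 3)})"
    if k: "k \<le> m - 2" and u: "u \<in> {t (k + 2)..t (k + 3)}" for k u
  proof -
    let ?C = "nth [quintic_break_coeff r k, break_coeff 3 (\<lambda>i. r (i + 1)) k, r (3 * k + 2),
        r (3 * k + 3), break_coeff 3 r (k + 1), quintic_break_coeff r (k + 1)]"
    let ?E = "nth [break_coeff 3 p k, p (3 * k + 1), p (3 * k + 2), p (3 * k + 3), break_coeff 3 p (k + 1)]"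
    let ?w = "\<lambda>u. (u - t (k + 2)) / d (k + 1)"
    have k1: "k \<le> m - 1" "k + 1 \<le> m - 1" using k two_le_m by auto
    have i: "3 * (k + 1) = 3 * k + 3" by simp
    have diff: "?C (Suc l) - ?C l = (d (k + 1) / 5) *\<^sub>R ?E l" if "l \<le> 4" for l
    proof -
      have "l = 0 \<or> l = 1 \<or> l = 2 \<or> l = 3 \<or> l = 4" using that by linarith
      then show ?thesis
        using quintic_break_differences[OF k1(1) r0[OF k1(1)] r1[OF k1(1)]]
          quintic_break_differences[OF k1(2) r0[OF k1(2)] r1[OF k1(2)], unfolded i] r2[OF k]
        by (elim disjE) (simp_all add: numeral_2_eq_2 numeral_3_eq_3)
    qed
    have "(bezier 5 ?C has_vector_derivative 5 *\<^sub>R bezier 4 (\<lambda>l. ?C (Suc l) - ?C l) (?w u)) (at (?w u))"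
      using has_vector_derivative_bezier[of 4 ?C "?w u"] by simp
    moreover have "bezier 4 (\<lambda>l. ?C (Suc l) - ?C l) (?w u) = bezier 4 (\<lambda>l. (d (k + 1) / 5) *\<^sub>R ?E l) (?w u)"
      by (intro bezier_cong diff)
    ultimately have "(bezier 5 ?C has_vector_derivative d (k + 1) *\<^sub>R bezier 4 ?E (?w u)) (at (?w u))"
      by (simp only: bezier_scaleR) simp
    moreover have "(?w has_vector_derivative 1 / d (k + 1)) (at u)"
      using d_pos[OF k]
      by (auto intro!: derivative_eq_intros simp: has_real_derivative_iff_has_vector_derivative[symmetric])
    ultimately have "(bezier 5 ?C \<circ> ?w has_vector_derivative
        (1 / d (k + 1)) *\<^sub>R (d (k + 1) *\<^sub>R bezier 4 ?E (?w u))) (at u)"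
      by (intro vector_diff_chain_at)
    moreover have "(1 / d (k + 1)) *\<^sub>R (d (k + 1) *\<^sub>R x) = x" for x :: 'a
      using less_imp_neq[OF d_pos[OF k]] by simp
    ultimately have "(bezier 5 ?C \<circ> ?w has_vector_derivative bezier 4 ?E (?w u)) (at u)"
      by (simp only:)
    then have "(bezier 5 ?C \<circ> ?w has_vector_derivative spline \<nu> 4 (3 * m - 2) p u)
        (at u within {t (k + 2)..t (k + 3)})"
      unfolding \<nu>_def clamped_quartic_spline_eq_bezier[OF k u] by (rule has_vector_derivative_at_within)
    then show ?thesis
      by (rule has_vector_derivative_transform[OF u, rotated])
        (simp only: clamped_quintic_spline_eq_bezier[OF k] o_def)
  qed
  \<comment> \<open>The pieces are glued one at a time from the left.\<close>
  have "(?R has_vector_derivative spline \<nu> 4 (3 * m - 2) p u) (at u within {t 2..t (j + 3)})"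
    if "j \<le> m - 2" "u \<in> {t 2..t (j + 3)}" for j u
    using that
  proof (induction j arbitrary: u)
    case 0
    then show ?case using piece[of 0 u, unfolded add_0] by simp
  next
    case (Suc j)
    have i: "Suc j + 2 = j + 3" by simp
    have jm: "j \<le> m - 2" "j + 3 \<le> m + 1" "Suc j + 3 \<le> m + 1" using Suc.prems by auto
    show ?case
    proof (rule has_vector_derivative_glue[of _ "t (j + 3)"])
      show "t 2 \<le> t (j + 3)" "t (j + 3) \<le> t (Suc j + 3)"
        using jm by (auto intro!: t_mono)
    qed (use Suc jm piece[of "Suc j", unfolded i] in auto)
  qed
  moreover have "m - 2 + 3 = m + 1" using two_le_m by simp
  ultimately show ?thesis using u by (metis order_refl)
qed

end

text \<open>This evaluates the nonic numerator at a breakpoint. The 5/9 terms combine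
  \<open>V\<close> and \<open>U\<close> into \<open>Q\<close>, the 4/9 terms combine
  \<open>s1\<close> and \<open>s0\<close> into \<open>S\<close>, and the two shares add up to the
  product \<open>Q * S\<close>.\<close>

lemma break_combination:
  fixes D :: complex
  assumes S: "S * D = s1 * a + s0 * b" and P: "P * D = p1 * a + p0 * b" and Q: "Q * D = V * a + U * b"
    and D: "D = a + b"
  shows "(5/9 * V * S + 4/9 * Q * s1 - x * (4/9 * p1 + 5/9 * P)) * a
    + (4/9 * Q * s0 + 5/9 * U * S - x * (4/9 * p0 + 5/9 * P)) * b = (Q * S - x * P) * D"
proof -
  have "(5/9 * V * S + 4/9 * Q * s1 - x * (4/9 * p1 + 5/9 * P)) * a
    + (4/9 * Q * s0 + 5/9 * U * S - x * (4/9 * p0 + 5/9 * P)) * b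
    = 5/9 * S * (V * a + U * b) + 4/9 * Q * (s1 * a + s0 * b)
      - x * (4/9 * (p1 * a + p0 * b) + 5/9 * P * (a + b))"
    by (simp add: algebra_simps add_divide_distrib)
  also have "\<dots> = (Q * S - x * P) * D"
    unfolding S[symmetric] P[symmetric] Q[symmetric] D[symmetric] by (simp add: algebra_simps)
  finally show ?thesis .
qed

section \<open>The offset curve as a rational spline of degree 9\<close>

theorem mainTheorem10:
  fixes m :: nat and t d :: "nat \<Rightarrow> real" and z p r :: "nat \<Rightarrow> complex"
    and \<sigma> :: "nat \<Rightarrow> real" and \<mu> \<nu> \<rho> \<tau> :: "real list"
    and D S \<gamma> :: "nat \<Rightarrow> real" and P U V Q q :: "nat \<Rightarrow> complex" and h :: real
  assumes m: "m \<ge> 2"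
    and t0: "t 2 = 0"
    and t_less: "\<And>k. 2 \<le> k \<Longrightarrow> k \<le> m \<Longrightarrow> t k < t (k+1)"
    and d: "\<And>k. 1 \<le> k \<Longrightarrow> k \<le> m-1 \<Longrightarrow> d k = t (k+2) - t (k+1)"
    and d0: "d 0 = 0" and dm: "d m = 0"
    and \<mu>: "\<mu> = clamped_knots 3 1 t m"
    and \<nu>: "\<nu> = clamped_knots 5 3 t m"
    and \<rho>: "\<rho> = clamped_knots 6 3 t m"
    and \<tau>: "\<tau> = clamped_knots 10 8 t m"
    and p: "\<And>u. u \<in> {t 2..t (m+1)} \<Longrightarrow> (spline \<mu> 2 m z u)\<^sup>2 = spline \<nu> 4 (3*m-2) p u"
    and \<sigma>: "\<And>u. u \<in> {t 2..t (m+1)} \<Longrightarrow>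
        spline \<mu> 2 m z u * cnj (spline \<mu> 2 m z u) = complex_of_real (spline \<nu> 4 (3*m-2) \<sigma> u)"
    and r: "\<And>i. i \<le> 3*m-2 \<Longrightarrow>
        r (i+1) = r i + complex_of_real ((\<nu> ! (i+5) - \<nu> ! i) / 5) * p i"
    and nz: "\<And>u. u \<in> {t 2..t (m+1)} \<Longrightarrow> spline \<mu> 2 m z u \<noteq> 0"
    and D: "\<And>k. k \<le> m-1 \<Longrightarrow> D k = d k + d (k+1)"
    and S: "\<And>k. k \<le> m-1 \<Longrightarrow> S k = (\<sigma> (3*k+1) * d k + \<sigma> (3*k) * d (k+1)) / D k"
    and P: "\<And>k. k \<le> m-1 \<Longrightarrow> P k = (p (3*k+1) * d k + p (3*k) * d (k+1)) / D k"
    and U: "\<And>k. k \<le> m-1 \<Longrightarrow> U k = (r (3*k+1) * d k + r (3*k) * d (k+1)) / D k"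
    and V: "\<And>k. k \<le> m-1 \<Longrightarrow> V k = (r (3*k+2) * d k + r (3*k+1) * d (k+1)) / D k"
    and Q: "\<And>k. k \<le> m-1 \<Longrightarrow>
        Q k = (r (3*k+2) * (d k)\<^sup>2 + 2 * r (3*k+1) * d k * d (k+1) + r (3*k) * (d (k+1))\<^sup>2) / (D k)\<^sup>2"
    and \<gamma>0: "\<And>k. k \<le> m-1 \<Longrightarrow> \<gamma> (8*k) = 4/9 * \<sigma> (3*k) + 5/9 * S k"
    and \<gamma>1: "\<And>k. k \<le> m-1 \<Longrightarrow> \<gamma> (8*k+1) = 5/9 * S k + 4/9 * \<sigma> (3*k+1)"
    and q0: "\<And>k. k \<le> m-1 \<Longrightarrow>
        q (8*k) = 4/9 * Q k * \<sigma> (3*k) + 5/9 * U k * S k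
          - \<i> * h * (4/9 * p (3*k) + 5/9 * P k)"
    and q1: "\<And>k. k \<le> m-1 \<Longrightarrow>
        q (8*k+1) = 5/9 * V k * S k + 4/9 * Q k * \<sigma> (3*k+1)
          - \<i> * h * (4/9 * p (3*k+1) + 5/9 * P k)"
    and \<gamma>2: "\<And>k. k \<le> m-2 \<Longrightarrow>
        \<gamma> (8*k+2) = 5/18 * S k + 5/9 * \<sigma> (3*k+1) + 1/6 * \<sigma> (3*k+2)"
    and \<gamma>3: "\<And>k. k \<le> m-2 \<Longrightarrow>
        \<gamma> (8*k+3) = 5/42 * S k + 10/21 * \<sigma> (3*k+1) + 5/14 * \<sigma> (3*k+2) + 1/21 * \<sigma> (3*k+3)"
    and \<gamma>4: "\<And>k. k \<le> m-2 \<Longrightarrow>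
        \<gamma> (8*k+4) = 5/126 * S k + 20/63 * \<sigma> (3*k+1) + 10/21 * \<sigma> (3*k+2)
          + 10/63 * \<sigma> (3*k+3) + 1/126 * S (k+1)"
    and \<gamma>5: "\<And>k. k \<le> m-2 \<Longrightarrow>
        \<gamma> (8*k+5) = 1/126 * S k + 10/63 * \<sigma> (3*k+1) + 10/21 * \<sigma> (3*k+2)
          + 20/63 * \<sigma> (3*k+3) + 5/126 * S (k+1)"
    and \<gamma>6: "\<And>k. k \<le> m-2 \<Longrightarrow>
        \<gamma> (8*k+6) = 1/21 * \<sigma> (3*k+1) + 5/14 * \<sigma> (3*k+2) + 10/21 * \<sigma> (3*k+3) + 5/42 * S (k+1)"
    and \<gamma>7: "\<And>k. k \<le> m-2 \<Longrightarrow>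
        \<gamma> (8*k+7) = 1/6 * \<sigma> (3*k+2) + 5/9 * \<sigma> (3*k+3) + 5/18 * S (k+1)"
    and q2: "\<And>k. k \<le> m-2 \<Longrightarrow>
        q (8*k+2) = 5/18 * r (3*k+2) * S k + 5/9 * V k * \<sigma> (3*k+1) + 1/6 * Q k * \<sigma> (3*k+2)
          - \<i> * h * (1/6 * p (3*k+2) + 5/9 * p (3*k+1) + 5/18 * P k)"
    and q3: "\<And>k. k \<le> m-2 \<Longrightarrow>
        q (8*k+3) = 5/42 * r (3*k+3) * S k + 10/21 * r (3*k+2) * \<sigma> (3*k+1)
          + 5/14 * V k * \<sigma> (3*k+2) + 1/21 * Q k * \<sigma> (3*k+3)
          - \<i> * h * (1/21 * p (3*k+3) + 5/14 * p (3*k+2) + 10/21 * p (3*k+1) + 5/42 * P k)"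
    and q4: "\<And>k. k \<le> m-2 \<Longrightarrow>
        q (8*k+4) = 5/126 * U (k+1) * S k + 20/63 * r (3*k+3) * \<sigma> (3*k+1)
          + 10/21 * r (3*k+2) * \<sigma> (3*k+2) + 10/63 * V k * \<sigma> (3*k+3) + 1/126 * Q k * S (k+1)
          - \<i> * h * (1/126 * P (k+1) + 10/63 * p (3*k+3) + 10/21 * p (3*k+2)
              + 20/63 * p (3*k+1) + 5/126 * P k)"
    and q5: "\<And>k. k \<le> m-2 \<Longrightarrow>
        q (8*k+5) = 1/126 * Q (k+1) * S k + 10/63 * U (k+1) * \<sigma> (3*k+1)
          + 10/21 * r (3*k+3) * \<sigma> (3*k+2) + 20/63 * r (3*k+2) * \<sigma> (3*k+3) + 5/126 * V k * S (k+1)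
          - \<i> * h * (5/126 * P (k+1) + 20/63 * p (3*k+3) + 10/21 * p (3*k+2)
              + 10/63 * p (3*k+1) + 1/126 * P k)"
    and q6: "\<And>k. k \<le> m-2 \<Longrightarrow>
        q (8*k+6) = 1/21 * Q (k+1) * \<sigma> (3*k+1) + 5/14 * U (k+1) * \<sigma> (3*k+2)
          + 10/21 * r (3*k+3) * \<sigma> (3*k+3) + 5/42 * r (3*k+2) * S (k+1)
          - \<i> * h * (5/42 * P (k+1) + 10/21 * p (3*k+3) + 5/14 * p (3*k+2) + 1/21 * p (3*k+1))"
    and q7: "\<And>k. k \<le> m-2 \<Longrightarrow>
        q (8*k+7) = 1/6 * Q (k+1) * \<sigma> (3*k+2) + 5/9 * U (k+1) * \<sigma> (3*k+3)
          + 5/18 * r (3*k+3) * S (k+1)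
          - \<i> * h * (5/18 * P (k+1) + 5/9 * p (3*k+3) + 1/6 * p (3*k+2))"
  shows "\<forall>u\<in>{t 2..t (m+1)}.
    spline \<tau> 9 (8*m-7) \<gamma> u \<noteq> 0 \<and>
    offset_curve (t 2) (t (m+1)) (spline \<rho> 5 (3*m-1) r) h u =
      spline \<tau> 9 (8*m-7) q u / complex_of_real (spline \<tau> 9 (8*m-7) \<gamma> u)"
proof
  interpret breakpoints m t d
    using m t_less d d0 dm by unfold_locales
  fix u assume u: "u \<in> {t 2..t (m + 1)}"
  then obtain k where k: "k \<le> m - 2" "u \<in> {t (k + 2)..t (k + 3)}"
    by (rule obtain_piece)
  define w where "w = (u - t (k + 2)) / d (k + 1)"
  have k1: "k \<le> m - 1" "k + 1 \<le> m - 1" using k m by auto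
  have i: "8 * (k + 1) + 1 = 8 * k + 9" "3 * (k + 1) = 3 * k + 3" "3 * k + 3 + 1 = 3 * k + 4"
    "3 * k + 3 + 2 = 3 * k + 5" "k + 1 + 1 = k + 2"
    by simp_all

  have D0: "D j \<noteq> 0" if "j \<le> m - 1" for j
    using d_add_pos[OF that] D[OF that] by simp
  have Dc: "complex_of_real (D j) = d j + d (j + 1)" if "j \<le> m - 1" for j
    using D[OF that] by simp
  have S': "break_coeff 3 \<sigma> j = S j" if "j \<le> m - 1" for j
    using S[OF that] D[OF that] by (simp add: break_coeff_def add_divide_distrib mult.commute)
  have bc: "break_coeff n c j = (c (n * j + 1) * d j + c (n * j) * d (j + 1)) / D j"
    if "j \<le> m - 1" for n j and c :: "nat \<Rightarrow> complex"
    using D[OF that]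
    by (simp add: break_coeff_def add_divide_distrib scaleR_conv_of_real mult.commute)
  have P': "break_coeff 3 p j = P j" and U': "break_coeff 3 r j = U j"
    and V': "break_coeff 3 (\<lambda>i. r (i + 1)) j = V j" if "j \<le> m - 1" for j
    using P[OF that] U[OF that] V[OF that] bc[OF that] by simp_all
  have D1: "1 - d j / (d j + d (j + 1)) = d (j + 1) / (d j + d (j + 1))" if "j \<le> m - 1" for j
    using d_add_pos[OF that] by (simp add: field_simps)
  have Q': "quintic_break_coeff r j = Q j" if "j \<le> m - 1" for j
    unfolding quintic_break_coeff_def Let_def D1[OF that] Q[OF that]
    unfolding D[OF that, symmetric]
    by (simp add: scaleR_conv_of_real power_divide add_divide_distrib power2_eq_square ac_simps)
  \<comment> \<open>As in de Casteljau's scheme, the two-step mixture \<open>Q\<close> is the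
    one-step mixture of \<open>V\<close> and \<open>U\<close> with the same weights.\<close>
  have QUV: "Q j = (V j * d j + U j * d (j + 1)) / D j" if "j \<le> m - 1" for j
    unfolding Q[OF that] U[OF that] V[OF that]
    using D0[OF that] by (simp add: field_simps power2_eq_square)
  have SD: "S j * D j = \<sigma> (3 * j + 1) * d j + \<sigma> (3 * j) * d (j + 1)" if "j \<le> m - 1" for j
    using S[OF that] D0[OF that] by simp
  have \<gamma>b: "break_coeff 8 \<gamma> j = S j" if "j \<le> m - 1" for j
  proof -
    have "\<gamma> (8 * j + 1) * d j + \<gamma> (8 * j) * d (j + 1) = S j * D j"
      using SD[OF that] unfolding \<gamma>0[OF that] \<gamma>1[OF that] D[OF that] by (simp add: algebra_simps)
    then have "(\<gamma> (8 * j + 1) * d j + \<gamma> (8 * j) * d (j + 1)) / D j = S j"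
      using D0[OF that] by simp
    then show ?thesis
      using D[OF that] by (simp add: break_coeff_def add_divide_distrib mult.commute)
  qed
  have qb: "break_coeff 8 q j = Q j * S j - \<i> * h * P j" if "j \<le> m - 1" for j
  proof -
    have Dj: "complex_of_real (D j) \<noteq> 0" using D0[OF that] by simp
    have "complex_of_real (S j) * D j = \<sigma> (3 * j + 1) * d j + \<sigma> (3 * j) * d (j + 1)"
      using arg_cong[OF SD[OF that], of complex_of_real] by simp
    moreover have "P j * D j = p (3 * j + 1) * d j + p (3 * j) * d (j + 1)"
      using P[OF that] Dj by simp
    moreover have "Q j * D j = V j * d j + U j * d (j + 1)"
      using QUV[OF that] Dj by simp
    ultimately have "q (8 * j + 1) * d j + q (8 * j) * d (j + 1) = (Q j * S j - \<i> * h * P j) * D j"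
      unfolding q0[OF that] q1[OF that] using Dc[OF that]
      by (intro break_combination) simp_all
    then show ?thesis unfolding bc[OF that] using Dj by simp
  qed

  let ?Z = "spline \<mu> 2 m z u"
  let ?p = "spline \<nu> 4 (3 * m - 2) p u" and ?\<sigma> = "spline \<nu> 4 (3 * m - 2) \<sigma> u"
  let ?r = "spline \<rho> 5 (3 * m - 1) r u"
  \<comment> \<open>The product of \<open>z\<close> and its conjugate is the squared modulus of
    \<open>z\<close>, which is also the modulus of \<open>z\<close> squared. So the \<sigma> spline
    is the speed of \<open>r\<close>, and it is nonzero because \<open>z\<close> is.\<close>
  have \<sigma>n: "?\<sigma> = (norm ?Z)\<^sup>2"
    using \<sigma>[OF u] by (simp only: complex_norm_square[symmetric] of_real_eq_iff)
  then have \<sigma>0: "?\<sigma> \<noteq> 0" using nz[OF u] by simp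
  have norm_p: "norm ?p = ?\<sigma>"
    unfolding p[OF u, symmetric] \<sigma>n by (rule norm_power)

  have "(spline \<rho> 5 (3 * m - 1) r has_vector_derivative ?p) (at u within {t 2..t (m + 1)})"
    unfolding \<nu> \<rho>
  proof (rule has_vector_derivative_clamped_quintic_spline[OF _ u])
    show "r (i + 1) = r i + ((clamped_knots 5 3 t m ! (i + 5) - clamped_knots 5 3 t m ! i) / 5) *\<^sub>R p i"
      if "i \<le> 3 * m - 2" for i
      using r[OF that] by (simp only: scaleR_conv_of_real \<nu>)
  qed
  \<comment> \<open>In a nondegenerate closed interval the derivative is unique, also where it is
    one-sided.\<close>
  moreover have "t 2 < t (m + 1)"
    using t_less[of 2] t_mono[of 3 "m + 1"] m by (simp add: numeral_3_eq_3 numeral_2_eq_2)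
  ultimately have "vector_derivative (spline \<rho> 5 (3 * m - 1) r) (at u within {t 2..t (m + 1)}) = ?p"
    using u by (intro vector_derivative_within_closed_interval) auto
  then have off: "offset_curve (t 2) (t (m + 1)) (spline \<rho> 5 (3 * m - 1) r) h u = ?r - \<i> * h * (?p / ?\<sigma>)"
    by (simp add: offset_curve_def norm_p)

  have p_bez: "?p = bezier 4 (nth [P k, p (3 * k + 1), p (3 * k + 2), p (3 * k + 3), P (k + 1)]) w"
    unfolding \<nu> clamped_quartic_spline_eq_bezier[OF k] P'[OF k1(1)] P'[OF k1(2)] w_def ..
  have \<sigma>_bez: "complex_of_real ?\<sigma> =
      bezier 4 (nth [complex_of_real (S k), complex_of_real (\<sigma> (3 * k + 1)),
        complex_of_real (\<sigma> (3 * k + 2)), complex_of_real (\<sigma> (3 * k + 3)), complex_of_real (S (k + 1))]) w"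
    unfolding \<nu> clamped_quartic_spline_eq_bezier[OF k] S'[OF k1(1)] S'[OF k1(2)] w_def of_real_bezier
    by (simp add: bezier_4)
  have r_bez: "?r = bezier 5 (nth [Q k, V k, r (3 * k + 2), r (3 * k + 3), U (k + 1), Q (k + 1)]) w"
    unfolding \<rho> clamped_quintic_spline_eq_bezier[OF k] Q'[OF k1(1)] Q'[OF k1(2)] V'[OF k1(1)]
      U'[OF k1(2)] w_def ..

  \<comment> \<open>The ten nonic control points are the quartic ones elevated to degree 9. Index 1
    belongs to breakpoint \<open>k\<close> and index 8 to breakpoint \<open>k + 1\<close>, hence
    \<gamma>1 at \<open>k\<close> and \<gamma>0 at \<open>k + 1\<close>.\<close>
  have \<gamma>_spline: "complex_of_real (spline \<tau> 9 (8 * m - 7) \<gamma> u) = ?\<sigma>"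
    unfolding \<sigma>_bez \<tau> clamped_nonic_spline_eq_bezier[OF k] \<gamma>b[OF k1(1)] \<gamma>b[OF k1(2)] w_def[symmetric] of_real_bezier
      \<gamma>0[OF k1(2)] \<gamma>1[OF k1(1)] \<gamma>2[OF k(1)] \<gamma>3[OF k(1)] \<gamma>4[OF k(1)] \<gamma>5[OF k(1)] \<gamma>6[OF k(1)] \<gamma>7[OF k(1)]
      i
    unfolding bezier_elevate_4_9 bezier_9 by simp
  \<comment> \<open>The numerator is the offset multiplied by the speed: a product of degrees 4 and
    5, minus the hodograph elevated from degree 4 to 9.\<close>
  have q_spline: "spline \<tau> 9 (8 * m - 7) q u = ?\<sigma> * ?r - \<i> * h * ?p"
    unfolding \<sigma>_bez r_bez p_bez \<tau> clamped_nonic_spline_eq_bezier[OF k] qb[OF k1(1)] qb[OF k1(2)] w_def[symmetric]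
      q0[OF k1(2)] q1[OF k1(1)] q2[OF k(1)] q3[OF k(1)] q4[OF k(1)] q5[OF k(1)] q6[OF k(1)] q7[OF k(1)]
      i
    unfolding bezier_mult_4_5 unfolding bezier_elevate_4_9 bezier_diff_mult[symmetric]
    unfolding bezier_9 by (simp add: ac_simps)
  have \<gamma>\<sigma>: "spline \<tau> 9 (8 * m - 7) \<gamma> u = ?\<sigma>"
    using \<gamma>_spline by (simp only: of_real_eq_iff)
  show "spline \<tau> 9 (8 * m - 7) \<gamma> u \<noteq> 0 \<and>
    offset_curve (t 2) (t (m + 1)) (spline \<rho> 5 (3 * m - 1) r) h u =
      spline \<tau> 9 (8 * m - 7) q u / complex_of_real (spline \<tau> 9 (8 * m - 7) \<gamma> u)"
    unfolding off q_spline \<gamma>\<sigma> using \<sigma>0 by (simp add: diff_divide_distrib)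
qed

end
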